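(* Let $\mathrm{A}$ be a complex $3$-dimensional binary $\mathfrak{perm}$ algebra with nonzero multiplication. Then $\mathrm{A}$ is isomorphic to one of the following algebras from the list in the context: $\mathrm{A}_{01},\dots,\mathrm{A}_{11}$, $\mathrm{A}_{12}$, $\mathrm{A}_{13}$, $\mathrm{A}_{14}^{\alpha}$ ($\alpha\in\mathbb{C}$, $\alpha\neq 0$), $\mathrm{A}_{16}$, $\mathrm{A}_{18}$, $\mathrm{A}_{21}$, $\mathrm{A}_{24}$; i.e., $\mathrm{A}$ is a $\mathfrak{perm}$ algebra.
   Context: A $\mathfrak{perm}$ algebra is an associative algebra (not necessarily unital) satisfying $abc=acb$ for all $a,b,c$. A (not necessarily associative) algebra is a binary $\mathfrak{perm}$ algebra if each of its subalgebras generated by two elements is a $\mathfrak{perm}$ algebra. The algebras below are given in a basis $e_1,e_2,e_3$. For $\mathrm{A}_{01},\dots,\mathrm{A}_{11}$ the multiplication is commutative, and products neither listed nor obtained from listed ones by commutativity are zero; for the others all products not listed are zero. $\mathrm{A}_{01}$: $e_1e_1=e_1$, $e_2e_2=e_2$; $\mathrm{A}_{02}$: $e_1e_1=e_1$, $e_1e_2=e_2$; $\mathrm{A}_{03}$: $e_1e_1=e_1$; $\mathrm{A}_{04}$: $e_1e_1=e_2$; $\mathrm{A}_{05}$: $e_1e_2=e_3$; $\mathrm{A}_{06}$: $e_1e_1=e_2$, $e_1e_2=e_3$; $\mathrm{A}_{07}$: $e_1e_1=e_1$, $e_2e_2=e_2$, $e_3e_3=e_3$; $\mathrm{A}_{08}$: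 $e_1e_1=e_1$, $e_2e_2=e_2$, $e_2e_3=e_3$; $\mathrm{A}_{09}$: $e_1e_1=e_1$, $e_1e_2=e_2$, $e_1e_3=e_3$; $\mathrm{A}_{10}$: $e_1e_1=e_1$, $e_1e_2=e_2$, $e_1e_3=e_3$, $e_2e_2=e_3$; $\mathrm{A}_{11}$: $e_1e_1=e_1$, $e_2e_2=e_3$; $\mathrm{A}_{12}$: $e_1e_2=e_3$, $e_2e_1=-e_3$; $\mathrm{A}_{13}$: $e_1e_1=e_2$, $e_1e_3=e_2$, $e_3e_1=-e_2$; $\mathrm{A}_{14}^{\alpha}$: $e_1e_2=(1+\alpha)e_3$, $e_2e_1=(1-\alpha)e_3$; $\mathrm{A}_{16}$: $e_1e_1=e_1$, $e_1e_3=e_3$, $e_2e_1=e_2$, $e_3e_1=e_3$; $\mathrm{A}_{18}$: $e_1e_1=e_1$, $e_2e_1=e_2$, $e_3e_1=e_3$; $\mathrm{A}_{21}$: $e_1e_1=e_1$, $e_2e_1=e_2$; $\mathrm{A}_{24}$: $e_1e_1=e_1$, $e_2e_2=e_2$, $e_3e_1=e_3$. *)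

theory Defs
  imports "HOL-Analysis.Analysis"
begin

text \<open>Algebras need be neither associative nor unital. The scalar multiplication is an explicit
  parameter, so that the vector space structure can be taken over any field.\<close>

locale nonassoc_algebra = vector_space smul
  for smul :: "'k::field \<Rightarrow> 'a::ab_group_add \<Rightarrow> 'a" +
  fixes mul :: "'a \<Rightarrow> 'a \<Rightarrow> 'a"
  assumes linear_mul_left: "\<And>y. Vector_Spaces.linear smul smul (\<lambda>x. mul x y)"
    and linear_mul_right: "\<And>x. Vector_Spaces.linear smul smul (\<lambda>y. mul x y)"

definition subalgebra ::
    "('k::field \<Rightarrow> 'a::ab_group_add \<Rightarrow> 'a) \<Rightarrow> ('a \<Rightarrow> 'a \<Rightarrow> 'a) \<Rightarrow> 'a set \<Rightarrow> bool" where
  "subalgebra smul mul S \<longleftrightarrow> module.subspace smul S \<and> (\<forall>x\<in>S. \<forall>y\<in>S. mul x y \<in> S)"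

definition generated_subalgebra ::
    "('k::field \<Rightarrow> 'a::ab_group_add \<Rightarrow> 'a) \<Rightarrow> ('a \<Rightarrow> 'a \<Rightarrow> 'a) \<Rightarrow> 'a set \<Rightarrow> 'a set" where
  "generated_subalgebra smul mul X = subalgebra smul mul hull X"

text \<open>The perm identities on a carrier \<open>S\<close>, which is meant to be a subalgebra.\<close>

definition perm_on :: "('a \<Rightarrow> 'a \<Rightarrow> 'a) \<Rightarrow> 'a set \<Rightarrow> bool" where
  "perm_on mul S \<longleftrightarrow>
     (\<forall>a\<in>S. \<forall>b\<in>S. \<forall>c\<in>S. mul (mul a b) c = mul a (mul b c)) \<and>
     (\<forall>a\<in>S. \<forall>b\<in>S. \<forall>c\<in>S. mul (mul a b) c = mul (mul a c) b)"

definition perm_algebra ::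
    "('k::field \<Rightarrow> 'a::ab_group_add \<Rightarrow> 'a) \<Rightarrow> ('a \<Rightarrow> 'a \<Rightarrow> 'a) \<Rightarrow> bool" where
  "perm_algebra smul mul \<longleftrightarrow> nonassoc_algebra smul mul \<and> perm_on mul UNIV"

definition binary_perm_algebra ::
    "('k::field \<Rightarrow> 'a::ab_group_add \<Rightarrow> 'a) \<Rightarrow> ('a \<Rightarrow> 'a \<Rightarrow> 'a) \<Rightarrow> bool" where
  "binary_perm_algebra smul mul \<longleftrightarrow>
     nonassoc_algebra smul mul \<and> (\<forall>x y. perm_on mul (generated_subalgebra smul mul {x, y}))"

definition algebra_isomorphic ::
    "('k::field \<Rightarrow> 'a::ab_group_add \<Rightarrow> 'a) \<Rightarrow> ('a \<Rightarrow> 'a \<Rightarrow> 'a) \<Rightarrow>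
     ('k \<Rightarrow> 'b::ab_group_add \<Rightarrow> 'b) \<Rightarrow> ('b \<Rightarrow> 'b \<Rightarrow> 'b) \<Rightarrow> bool" where
  "algebra_isomorphic smul1 mul1 smul2 mul2 \<longleftrightarrow>
     (\<exists>f. Vector_Spaces.linear smul1 smul2 f \<and> bij f \<and>
          (\<forall>x y. f (mul1 x y) = mul2 (f x) (f y)))"

abbreviation ee :: "3 \<Rightarrow> complex ^ 3" where
  "ee i \<equiv> axis i 1"

text \<open>The bilinear multiplication sending \<open>(ee i, ee j)\<close> to \<open>t (i, j)\<close>.\<close>

definition table_mult ::
    "(3 \<times> 3 \<Rightarrow> complex ^ 3) \<Rightarrow> complex ^ 3 \<Rightarrow> complex ^ 3 \<Rightarrow> complex ^ 3" where
  "table_mult t x y = (\<Sum>i\<in>UNIV. \<Sum>j\<in>UNIV. (x $ i * y $ j) *s t (i, j))"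

lemma table_mult_ee: "table_mult t (ee i) (ee j) = t (i, j)"
proof -
  have "(\<Sum>l\<in>UNIV. (ee i $ k * ee j $ l) *s t (k, l)) = (if k = i then t (k, j) else 0)" for k
  proof -
    have "(ee i $ k * ee j $ l) *s t (k, l)
          = (if l = j then if k = i then t (k, l) else 0 else 0)" for l
      by (simp add: axis_def)
    then show ?thesis by (simp only: sum.delta finite UNIV_I if_True)
  qed
  then show ?thesis by (simp add: table_mult_def)
qed

lemma nonassoc_algebra_table_mult: "nonassoc_algebra (*s) (table_mult t)"
  by unfold_locales
    (simp_all add: table_mult_def vec_eq_iff algebra_simps sum.distrib sum_distrib_left)

text \<open>Products missing from a table are zero. In the commutative tables \<open>A01\<close> to \<open>A11\<close>, both
  orders of each product are written out.\<close>

definition "A01 = table_mult ((\<lambda>_. 0)((1,1) := ee 1, (2,2) := ee 2))"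

definition "A02 = table_mult ((\<lambda>_. 0)((1,1) := ee 1, (1,2) := ee 2, (2,1) := ee 2))"

definition "A03 = table_mult ((\<lambda>_. 0)((1,1) := ee 1))"

definition "A04 = table_mult ((\<lambda>_. 0)((1,1) := ee 2))"

definition "A05 = table_mult ((\<lambda>_. 0)((1,2) := ee 3, (2,1) := ee 3))"

definition "A06 = table_mult ((\<lambda>_. 0)((1,1) := ee 2, (1,2) := ee 3, (2,1) := ee 3))"

definition "A07 = table_mult ((\<lambda>_. 0)((1,1) := ee 1, (2,2) := ee 2, (3,3) := ee 3))"

definition "A08 = table_mult ((\<lambda>_. 0)((1,1) := ee 1, (2,2) := ee 2,
  (2,3) := ee 3, (3,2) := ee 3))"

definition "A09 = table_mult ((\<lambda>_. 0)((1,1) := ee 1, (1,2) := ee 2, (2,1) := ee 2,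
  (1,3) := ee 3, (3,1) := ee 3))"

definition "A10 = table_mult ((\<lambda>_. 0)((1,1) := ee 1, (1,2) := ee 2, (2,1) := ee 2,
  (1,3) := ee 3, (3,1) := ee 3, (2,2) := ee 3))"

definition "A11 = table_mult ((\<lambda>_. 0)((1,1) := ee 1, (2,2) := ee 3))"

definition "A12 = table_mult ((\<lambda>_. 0)((1,2) := ee 3, (2,1) := - ee 3))"

definition "A13 = table_mult ((\<lambda>_. 0)((1,1) := ee 2, (1,3) := ee 2, (3,1) := - ee 2))"

definition "A14 \<alpha> = table_mult ((\<lambda>_. 0)((1,2) := (1 + \<alpha>) *s ee 3, (2,1) := (1 - \<alpha>) *s ee 3))"

definition "A16 = table_mult ((\<lambda>_. 0)((1,1) := ee 1, (1,3) := ee 3,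
  (2,1) := ee 2, (3,1) := ee 3))"

definition "A18 = table_mult ((\<lambda>_. 0)((1,1) := ee 1, (2,1) := ee 2, (3,1) := ee 3))"

definition "A21 = table_mult ((\<lambda>_. 0)((1,1) := ee 1, (2,1) := ee 2))"

definition "A24 = table_mult ((\<lambda>_. 0)((1,1) := ee 1, (2,2) := ee 2, (3,1) := ee 3))"

end

theory Submission
  imports Defs "HOL-Computational_Algebra.Fundamental_Theorem_Algebra"
begin

text \<open>If two elements generate \<open>A\<close>, then \<open>A\<close> is perm by hypothesis. Otherwise any two vectors span a
  subalgebra, which forces \<open>x y = f(y) x\<close> with \<open>f\<close> linear, and such an algebra is perm.

  For a perm algebra, Fitting's lemma yields an idempotent unless all elements are nilpotent. In the
  nil case there is either \<open>x\<close> with \<open>x\<^sup>3 \<noteq> 0\<close> (\<open>A06\<close>), or all squares vanish (\<open>A12\<close>), or all triple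
  products vanish and the product is a bilinear form on a plane with values in the line of some
  \<open>x\<^sup>2\<close>; the discriminant of its quadratic form separates \<open>A04\<close>, \<open>A13\<close> from \<open>A05\<close>, \<open>A14\<close>. If there are
  two orthogonal idempotents, the third basis vector can be taken homogeneous for both Peirce
  decompositions. If there is an idempotent \<open>e\<close> but no such pair, then \<open>e\<close> extends to a basis by two
  nilpotent Peirce-homogeneous vectors, whose types determine the algebra up to a nil plane.\<close>

section \<open>Linear independence of two and three vectors\<close>

locale linear_space = vector_space smul
  for smul :: "'k::field \<Rightarrow> 'b::ab_group_add \<Rightarrow> 'b" (infixr \<open>\<odot>\<close> 75)
begin

text \<open>Independence is phrased by coefficients because \<open>independent {u, v}\<close> cannot
  see a repetition: \<open>{u, u}\<close> is a singleton. The later proofs compare coefficients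
  anyway.\<close>

definition indep2 :: "'b \<Rightarrow> 'b \<Rightarrow> bool" where
  "indep2 u v \<longleftrightarrow> (\<forall>a b. a \<odot> u + b \<odot> v = 0 \<longrightarrow> a = 0 \<and> b = 0)"

definition indep3 :: "'b \<Rightarrow> 'b \<Rightarrow> 'b \<Rightarrow> bool" where
  "indep3 u v w \<longleftrightarrow>
     (\<forall>a b c. a \<odot> u + b \<odot> v + c \<odot> w = 0 \<longrightarrow> a = 0 \<and> b = 0 \<and> c = 0)"

lemma indep2D: "indep2 u v \<Longrightarrow> a \<odot> u + b \<odot> v = 0 \<Longrightarrow> a = 0 \<and> b = 0"
  by (simp add: indep2_def)

lemma indep3D: "indep3 u v w \<Longrightarrow> a \<odot> u + b \<odot> v + c \<odot> w = 0 \<Longrightarrow> a = 0 \<and> b = 0 \<and> c = 0"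
  by (simp add: indep3_def)

lemma not_indep2_nonzeroD:
  assumes "u \<noteq> 0" "\<not> indep2 u v"
  shows "\<exists>a. v = a \<odot> u"
proof -
  obtain a b where ab: "a \<odot> u + b \<odot> v = 0" "a \<noteq> 0 \<or> b \<noteq> 0"
    using assms(2) by (auto simp: indep2_def)
  have "b \<noteq> 0" using ab assms(1) by auto
  have "b \<odot> v = - a \<odot> u" using ab(1) by (simp add: eq_neg_iff_add_eq_0 add.commute)
  then have "inverse b \<odot> (b \<odot> v) = inverse b \<odot> (- a \<odot> u)" by simp
  then have "v = (inverse b * - a) \<odot> u" using \<open>b \<noteq> 0\<close> by (simp only: scale_scale) simp
  then show ?thesis by blast
qed

lemma not_indep3D:
  assumes "indep2 u v" "\<not> indep3 u v w"
  shows "\<exists>a b. w = a \<odot> u + b \<odot> v"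
proof -
  obtain a b c where abc: "a \<odot> u + b \<odot> v + c \<odot> w = 0" "a \<noteq> 0 \<or> b \<noteq> 0 \<or> c \<noteq> 0"
    using assms(2) by (auto simp: indep3_def)
  have "c \<noteq> 0" using abc indep2D[OF assms(1), of a b] by auto
  have "c \<odot> w = (- a) \<odot> u + (- b) \<odot> v"
    using abc(1) by (simp add: eq_neg_iff_add_eq_0 algebra_simps)
  then have "inverse c \<odot> (c \<odot> w) = inverse c \<odot> ((- a) \<odot> u + (- b) \<odot> v)" by simp
  then have "w = (inverse c * - a) \<odot> u + (inverse c * - b) \<odot> v"
    using \<open>c \<noteq> 0\<close> by (simp only: scale_scale scale_right_distrib) simp
  then show ?thesis by blast
qed

lemma indep3_imp_indep2: "indep3 u v w \<Longrightarrow> indep2 u v"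
  unfolding indep2_def using indep3D[of u v w _ _ 0] by simp

lemma indep2_imp_nonzero: "indep2 u v \<Longrightarrow> u \<noteq> 0"
  using indep2D[of u v 1 0] by auto

lemma indep3_swap12:
  assumes "indep3 u v w"
  shows "indep3 v u w"
proof (unfold indep3_def, intro allI impI)
  fix a b c assume "a \<odot> v + b \<odot> u + c \<odot> w = 0"
  then show "a = 0 \<and> b = 0 \<and> c = 0"
    using indep3D[OF assms, of b a c] by (simp add: add.commute)
qed

lemma indep3_swap23:
  assumes "indep3 u v w"
  shows "indep3 u w v"
proof (unfold indep3_def, intro allI impI)
  fix a b c assume "a \<odot> u + b \<odot> w + c \<odot> v = 0"
  then show "a = 0 \<and> b = 0 \<and> c = 0"
    using indep3D[OF assms, of a c b] by (simp add: add_ac)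
qed

lemma in_span1: "x \<in> span {u} \<longleftrightarrow> (\<exists>a. x = a \<odot> u)"
  by (auto simp: span_breakdown_eq)

lemma in_span2: "x \<in> span {u, v} \<longleftrightarrow> (\<exists>a b. x = a \<odot> u + b \<odot> v)"
  by (auto simp: span_breakdown_eq algebra_simps)

lemma in_span3: "x \<in> span {u, v, w} \<longleftrightarrow> (\<exists>a b c. x = a \<odot> u + b \<odot> v + c \<odot> w)"
  by (auto simp: span_breakdown_eq algebra_simps)

text \<open>This is the bridge to the dimension theory of sets; the cardinality restores what the
  set notation forgets.\<close>

lemma indep3_independent:
  assumes "indep3 u v w"
  shows "independent {u, v, w}" "card {u, v, w} = 3"
proof -
  have w: "w \<notin> span {u, v}"
  proof
    assume "w \<in> span {u, v}"
    then obtain a b where "w = a \<odot> u + b \<odot> v" by (auto simp: in_span2)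
    then have "a \<odot> u + b \<odot> v + (- 1) \<odot> w = 0" by simp
    then show False using indep3D[OF assms] by fastforce
  qed
  have v: "v \<notin> span {u}"
  proof
    assume "v \<in> span {u}"
    then obtain a where "v = a \<odot> u" by (auto simp: in_span1)
    then have "a \<odot> u + (- 1) \<odot> v + 0 \<odot> w = 0" by simp
    then show False using indep3D[OF assms] by fastforce
  qed
  have u: "u \<noteq> 0" using indep2_imp_nonzero indep3_imp_indep2 assms by blast
  have "u \<noteq> v" "w \<noteq> u" "w \<noteq> v"
    using v w span_base[of u "{u}"] span_base[of u "{u, v}"] span_base[of v "{u, v}"] by auto
  then show "card {u, v, w} = 3" by auto
  have "independent {v, u}" by (rule independent_insertI[OF v]) (simp add: u)
  then have "independent {u, v}" by (simp add: insert_commute)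
  then have "independent {w, u, v}" by (rule independent_insertI[OF w])
  moreover have "{w, u, v} = {u, v, w}" by auto
  ultimately show "independent {u, v, w}" by simp
qed

end

section \<open>Three-dimensional algebras and their multiplication tables\<close>

locale algebra3 = linear_space smul + nonassoc_algebra smul mul
  for smul :: "complex \<Rightarrow> 'a::ab_group_add \<Rightarrow> 'a" (infixr \<open>\<odot>\<close> 75)
    and mul :: "'a \<Rightarrow> 'a \<Rightarrow> 'a" (infixl \<open>\<cdot>\<close> 70) +
  assumes dim3: "dim UNIV = 3"
begin

text \<open>A basis extending the three vectors has three elements, so nothing was added.\<close>

lemma indep3_spans:
  assumes "indep3 u v w"
  obtains a b c where "x = a \<odot> u + b \<odot> v + c \<odot> w"
proof -
  obtain C where C: "{u, v, w} \<subseteq> C" "independent C" "UNIV \<subseteq> span C"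
    by (rule maximal_independent_subset_extend[OF subset_UNIV indep3_independent(1)[OF assms]])
  have "card C = 3" using basis_card_eq_dim[of C UNIV] C dim3 by simp
  then have "C = {u, v, w}"
    using card_subset_eq[of C "{u, v, w}"] C(1) indep3_independent(2)[OF assms]
    by (metis card.infinite zero_neq_numeral)
  then have "x \<in> span {u, v, w}" using C(3) by auto
  then show thesis using that by (auto simp: in_span3)
qed

text \<open>If no element of \<open>P\<close> worked, \<open>P\<close> would span at most a line.
  Allowing any spanning set \<open>P\<close> makes it possible later to choose Peirce-homogeneous
  basis vectors.\<close>

lemma exists_indep2:
  assumes "span P = UNIV" "u \<noteq> 0"
  shows "\<exists>v\<in>P. indep2 u v"
proof (rule ccontr)
  assume "\<not> ?thesis"
  then have "P \<subseteq> span {u}" using not_indep2_nonzeroD[OF assms(2)] by (auto simp: in_span1)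
  then have "dim UNIV \<le> card {u}" using assms(1) dim_le_card[of UNIV "{u}"] span_minimal[of P "span {u}"]
    by simp
  then show False using dim3 by simp
qed

lemma exists_indep3:
  assumes "span P = UNIV" "indep2 u v"
  shows "\<exists>w\<in>P. indep3 u v w"
proof (rule ccontr)
  assume "\<not> ?thesis"
  then have "P \<subseteq> span {u, v}" using not_indep3D[OF assms(2)] by (auto simp: in_span2)
  then have "dim UNIV \<le> card {u, v}"
    using assms(1) dim_le_card[of UNIV "{u, v}"] span_minimal[of P "span {u, v}"] by simp
  also have "\<dots> \<le> 2" by (simp add: card_insert_if)
  finally show False using dim3 by simp
qed

text \<open>The vectors may coincide, so this applies directly to the powers of an element.\<close>

lemma dependent4:
  obtains a b c d where "a \<odot> x + b \<odot> y + c \<odot> z + d \<odot> w = 0" "a \<noteq> 0 \<or> b \<noteq> 0 \<or> c \<noteq> 0 \<or> d \<noteq> 0"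
proof (cases "indep3 x y z")
  case True
  then obtain a b c where "w = a \<odot> x + b \<odot> y + c \<odot> z" by (rule indep3_spans)
  then have "a \<odot> x + b \<odot> y + c \<odot> z + (- 1) \<odot> w = 0" by simp
  then show ?thesis using that[of a b c "-1"] by simp
next
  case False
  then obtain a b c where "a \<odot> x + b \<odot> y + c \<odot> z = 0" "a \<noteq> 0 \<or> b \<noteq> 0 \<or> c \<noteq> 0"
    by (auto simp: indep3_def)
  then show ?thesis using that[of a b c 0] by simp
qed

lemma mul_add_left: "(x + y) \<cdot> z = x \<cdot> z + y \<cdot> z"
  using linear_mul_left[of z] by (simp add: Vector_Spaces.linear_iff)

lemma mul_add_right: "z \<cdot> (x + y) = z \<cdot> x + z \<cdot> y"
  using linear_mul_right[of z] by (simp add: Vector_Spaces.linear_iff)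

lemma mul_scale_left: "(a \<odot> x) \<cdot> z = a \<odot> (x \<cdot> z)"
  using linear_mul_left[of z] by (simp add: Vector_Spaces.linear_iff)

lemma mul_scale_right: "z \<cdot> (a \<odot> x) = a \<odot> (z \<cdot> x)"
  using linear_mul_right[of z] by (simp add: Vector_Spaces.linear_iff)

lemma mul_zero_left [simp]: "0 \<cdot> x = 0"
  using mul_add_left[of 0 0 x] by simp

lemma mul_zero_right [simp]: "x \<cdot> 0 = 0"
  using mul_add_right[of x 0 0] by simp

lemma mul_minus_left: "(- x) \<cdot> y = - (x \<cdot> y)"
  using mul_scale_left[of "-1" x y] by simp

lemma mul_minus_right: "y \<cdot> (- x) = - (y \<cdot> x)"
  using mul_scale_right[of y "-1" x] by simp

lemma mul_diff_left: "(x - y) \<cdot> z = x \<cdot> z - y \<cdot> z"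
  using mul_add_left[of x "-y" z] by (simp add: mul_minus_left)

lemma mul_diff_right: "z \<cdot> (x - y) = z \<cdot> x - z \<cdot> y"
  using mul_add_right[of z x "-y"] by (simp add: mul_minus_right)

lemmas mul_linear = mul_add_left mul_add_right mul_scale_left mul_scale_right
  mul_minus_left mul_minus_right mul_diff_left mul_diff_right scale_right_distrib
  scale_right_diff_distrib

text \<open>Every isomorphism of the classification comes from here: a basis and its nine products
  determine the algebra. \<open>comb\<close> turns coordinates into vectors.\<close>

lemma iso_table:
  fixes u v w t
  defines "comb \<equiv> \<lambda>x :: complex ^ 3. x $ 1 \<odot> u + x $ 2 \<odot> v + x $ 3 \<odot> w"
  assumes basis: "indep3 u v w"
    and "u \<cdot> u = comb (t (1, 1))" "u \<cdot> v = comb (t (1, 2))" "u \<cdot> w = comb (t (1, 3))"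
    and "v \<cdot> u = comb (t (2, 1))" "v \<cdot> v = comb (t (2, 2))" "v \<cdot> w = comb (t (2, 3))"
    and "w \<cdot> u = comb (t (3, 1))" "w \<cdot> v = comb (t (3, 2))" "w \<cdot> w = comb (t (3, 3))"
  shows "algebra_isomorphic smul mul (*s) (table_mult t)"
proof -
  have vs: "vector_space ((*s) :: complex \<Rightarrow> complex ^ 3 \<Rightarrow> complex ^ 3)"
    using nonassoc_algebra_table_mult[of t] by (simp add: nonassoc_algebra_def)
  have lin: "comb (x + y) = comb x + comb y" "comb (c *s x) = c \<odot> comb x" for x y c
    by (simp_all add: comb_def algebra_simps)
  have comb_mult: "comb (table_mult t x y) = comb x \<cdot> comb y" for x y
  proof -
    have "comb x \<cdot> comb y =
        (x $ 1 * y $ 1) \<odot> (u \<cdot> u) + (x $ 1 * y $ 2) \<odot> (u \<cdot> v) + (x $ 1 * y $ 3) \<odot> (u \<cdot> w)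
      + ((x $ 2 * y $ 1) \<odot> (v \<cdot> u) + (x $ 2 * y $ 2) \<odot> (v \<cdot> v) + (x $ 2 * y $ 3) \<odot> (v \<cdot> w))
      + ((x $ 3 * y $ 1) \<odot> (w \<cdot> u) + (x $ 3 * y $ 2) \<odot> (w \<cdot> v) + (x $ 3 * y $ 3) \<odot> (w \<cdot> w))"
      by (simp add: comb_def mul_linear algebra_simps)
    then show ?thesis
      by (simp only: assms(3-) table_mult_def sum_3 lin)
  qed
  have inj: "inj comb"
  proof (rule injI)
    fix x y assume "comb x = comb y"
    then have "comb (x - y) = 0" using lin(1)[of "x - y" y] by simp
    then have "(x - y) $ 1 = 0 \<and> (x - y) $ 2 = 0 \<and> (x - y) $ 3 = 0"
      unfolding comb_def by (rule indep3D[OF basis])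
    then show "x = y" by (simp add: vec_eq_iff forall_3)
  qed
  have surj: "\<exists>y. x = comb y" for x
  proof -
    obtain a b c where "x = a \<odot> u + b \<odot> v + c \<odot> w" by (rule indep3_spans[OF basis])
    then have "x = comb (vector [a, b, c])" by (simp add: comb_def)
    then show ?thesis by blast
  qed
  have bij: "bij comb" using inj surj by (auto simp: bij_def)
  \<comment> \<open>\<open>comb\<close> goes from the table algebra to the given one, whereas
    \<open>algebra_isomorphic\<close> asks for the opposite direction.\<close>
  define f where "f = inv comb"
  have [simp]: "f (comb x) = x" "comb (f y) = y" for x y
    using bij by (simp_all add: f_def bij_is_inj bij_is_surj surj_f_inv_f)
  have "f (x + y) = f x + f y" "f (c \<odot> x) = c *s f x" "f (x \<cdot> y) = table_mult t (f x) (f y)"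
    for x y c
    by (rule injD[OF inj], simp add: lin comb_mult)+
  then have "Vector_Spaces.linear smul (*s) f"
    by (simp add: Vector_Spaces.linear_iff vector_space_axioms vs)
  moreover have "bij f" using bij by (simp add: f_def bij_imp_bij_inv)
  ultimately show ?thesis
    unfolding algebra_isomorphic_def
    using \<open>\<And>x y. f (x \<cdot> y) = table_mult t (f x) (f y)\<close> by blast
qed

end

section \<open>Binary perm algebras of dimension three are perm\<close>

context algebra3
begin

text \<open>For fixed \<open>y\<close> every vector is an eigenvector of right multiplication by
  \<open>y\<close>. Comparing \<open>x0\<close>, \<open>x\<close> and \<open>x0 + x\<close> shows
  that the eigenvalue \<open>f y\<close> is the same for all of them, and then both bracketings of a
  triple product scale \<open>a\<close> by \<open>f b * f c\<close>, which is symmetric in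
  \<open>b\<close> and \<open>c\<close>.\<close>

lemma perm_if_mul_scales_left:
  assumes eig: "\<And>x y. \<exists>c. x \<cdot> y = c \<odot> x"
  shows "perm_on mul UNIV"
proof -
  have "\<exists>x. x \<noteq> (0::'a)"
  proof (rule ccontr)
    assume "\<not> ?thesis"
    then have "(UNIV::'a set) = {0}" by auto
    then have "dim UNIV \<le> card ({} :: 'a set)" by (intro dim_le_card) auto
    then show False using dim3 by simp
  qed
  then obtain x0 :: 'a where "x0 \<noteq> 0" ..
  have "\<exists>c. \<forall>x. x \<cdot> y = c \<odot> x" for y
  proof -
    obtain c where c: "x0 \<cdot> y = c \<odot> x0" using eig by blast
    have "x \<cdot> y = c \<odot> x" for x
    proof (cases "indep2 x0 x")
      case True
      obtain a b where ab: "x \<cdot> y = a \<odot> x" "(x0 + x) \<cdot> y = b \<odot> (x0 + x)" using eig by metis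
      have "(c - b) \<odot> x0 + (a - b) \<odot> x = 0"
        using ab c by (simp add: mul_linear algebra_simps)
      then have "c - b = 0 \<and> a - b = 0" by (rule indep2D[OF True])
      then show ?thesis using ab by simp
    next
      case False
      then obtain k where "x = k \<odot> x0" using not_indep2_nonzeroD[OF \<open>x0 \<noteq> 0\<close>] by blast
      then show ?thesis using c by (simp add: mul_linear mult.commute)
    qed
    then show ?thesis by blast
  qed
  then obtain f where f: "x \<cdot> y = f y \<odot> x" for x y by metis
  have "a \<cdot> (b \<cdot> c) = f c \<odot> f b \<odot> a" for a b c
    using f[of a b] by (simp only: f[of b c] mul_scale_right)
  moreover have "a \<cdot> b \<cdot> c = f c \<odot> f b \<odot> a" for a b c by (simp only: f)
  ultimately show ?thesis unfolding perm_on_def by (simp add: mult.commute)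
qed

text \<open>If no two elements generate the algebra, then independent \<open>x\<close>, \<open>y\<close> generate no more than
  their span. Intersecting two such planes shows that every line is a subalgebra, and then
  \<open>x \<cdot> y\<close> lies on the line of \<open>x\<close>.\<close>

lemma perm_on_if_binary_perm:
  assumes binary: "\<And>x y. perm_on mul (generated_subalgebra smul mul {x, y})"
  shows "perm_on mul UNIV"
proof -
  define G where "G x y = generated_subalgebra smul mul {x, y}" for x y
  have subalg: "subalgebra smul mul (G x y)" for x y
    unfolding G_def generated_subalgebra_def
    by (rule hull_in) (auto simp: subalgebra_def subspace_def)
  have G: "x \<in> G x y" "y \<in> G x y" for x y
    using hull_subset[of "{x, y}" "subalgebra smul mul"]
    by (auto simp: G_def generated_subalgebra_def)
  have Gsub: "subspace (G x y)" and Gmul: "u \<in> G x y \<Longrightarrow> v \<in> G x y \<Longrightarrow> u \<cdot> v \<in> G x y" for x y u v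
    using subalg[of x y] by (auto simp: subalgebra_def)
  have Gassoc: "u \<cdot> v \<cdot> w = u \<cdot> (v \<cdot> w)" and Gperm: "u \<cdot> v \<cdot> w = u \<cdot> w \<cdot> v"
    if "u \<in> G x y" "v \<in> G x y" "w \<in> G x y" for x y u v w
    using binary[of x y] that by (auto simp: perm_on_def G_def)
  show ?thesis
  proof (cases "\<exists>x y. G x y = UNIV")
    case True
    then obtain x y where "G x y = UNIV" by blast
    then show ?thesis using binary[of x y] by (simp add: G_def)
  next
    case False
    \<comment> \<open>A third independent vector would make \<open>G x y\<close> the whole
      space.\<close>
    have in_span: "\<exists>a b. w = a \<odot> x + b \<odot> y" if "indep2 x y" "w \<in> G x y" for x y w
    proof (rule ccontr)
      assume "\<not> ?thesis"
      then have ind: "indep3 x y w" using not_indep3D that(1) by blast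
      have "v \<in> G x y" for v
      proof -
        obtain a b c where "v = a \<odot> x + b \<odot> y + c \<odot> w" by (rule indep3_spans[OF ind])
        then show ?thesis using G(1)[of x y] G(2)[of y x] that(2) Gsub[of x y]
          by (simp add: subspace_add subspace_scale)
      qed
      then show False using False by blast
    qed
    have sq: "\<exists>a. x \<cdot> x = a \<odot> x" for x
    proof (cases "x = 0")
      case False
      obtain y where y: "indep2 x y" using exists_indep2[of UNIV x] False by auto
      obtain z where z: "indep3 x y z" using exists_indep3[of UNIV x y] y by auto
      have z2: "indep2 x z" using indep3_imp_indep2[OF indep3_swap23[OF z]] .
      obtain a b where 1: "x \<cdot> x = a \<odot> x + b \<odot> y" using in_span[OF y] Gmul G by meson
      obtain c d where 2: "x \<cdot> x = c \<odot> x + d \<odot> z" using in_span[OF z2] Gmul G by meson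
      have "(a - c) \<odot> x + b \<odot> y + (- d) \<odot> z = 0"
        using 1 2 by (simp add: scale_left_diff_distrib algebra_simps)
      then have "b = 0" using indep3D[OF z] by blast
      then show ?thesis using 1 by auto
    qed auto
    have "\<exists>c. x \<cdot> y = c \<odot> x" for x y
    proof (cases "indep2 x y")
      case False
      show ?thesis
      proof (cases "x = 0")
        case False
        then obtain k where "y = k \<odot> x"
          using not_indep2_nonzeroD \<open>\<not> indep2 x y\<close> by blast
        then show ?thesis using sq[of x] by (auto simp: mul_linear)
      qed auto
    next
      case True
      obtain g where g: "x \<cdot> x = g \<odot> x" using sq by blast
      obtain a b where ab: "x \<cdot> y = a \<odot> x + b \<odot> y" using in_span[OF True] Gmul G by meson
      obtain c d where cd: "y \<cdot> x = c \<odot> x + d \<odot> y" using in_span[OF True] Gmul G by meson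
      \<comment> \<open>Comparing with \<open>x \<cdot> x \<cdot> y\<close> leaves
        \<open>b = 0\<close> or \<open>x \<cdot> y = g \<odot> y\<close>.\<close>
      have "x \<cdot> (x \<cdot> y) = g \<odot> (x \<cdot> y)"
        using Gassoc[of x x y x y] G(1)[of x y] G(2)[of y x] g by (simp add: mul_linear)
      then have "(a * g + b * a - g * a) \<odot> x + (b * b - g * b) \<odot> y = 0"
        using ab g by (simp add: mul_linear algebra_simps)
      then have "a * g + b * a - g * a = 0 \<and> b * b - g * b = 0" by (rule indep2D[OF True])
      then have ba: "b = 0 \<or> b = g \<and> a * b = 0" by (auto simp: algebra_simps)
      have "b = 0"
      proof (rule ccontr)
        assume "b \<noteq> 0"
        then have [simp]: "b = g" "a = 0" and "g \<noteq> 0" using ba by auto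
        \<comment> \<open>The perm identity forces \<open>y \<cdot> x = g \<odot> y\<close> as
          well.\<close>
        have "x \<cdot> (y \<cdot> x) = x \<cdot> (x \<cdot> y)"
          using Gassoc[of x x y y x] Gperm[of x x y y x] Gassoc[of x x y x y]
            G(1)[of x y] G(2)[of y x] by simp
        then have "(c * g) \<odot> x + (d * g - g * g) \<odot> y = 0"
          using ab cd g by (simp add: mul_linear algebra_simps)
        then have "c * g = 0 \<and> d * g - g * g = 0" by (rule indep2D[OF True])
        then have [simp]: "c = 0" "d = g" using \<open>g \<noteq> 0\<close> by auto
        obtain h where h: "y \<cdot> y = h \<odot> y" using sq by blast
        \<comment> \<open>The square of \<open>k \<odot> x + y\<close> must be a multiple of this
          vector. This determines \<open>h\<close> from every nonzero \<open>k\<close>, and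
          \<open>k = 1\<close> and \<open>k = 2\<close> disagree.\<close>
        have "h = - k * g" if "k \<noteq> 0" for k
        proof -
          obtain l where "(k \<odot> x + y) \<cdot> (k \<odot> x + y) = l \<odot> (k \<odot> x + y)" using sq by blast
          moreover have "(k * g + k * g) \<odot> y = (k * g) \<odot> y + (k * g) \<odot> y"
            by (rule scale_left_distrib)
          ultimately have "(k * k * g - l * k) \<odot> x + (k * g + k * g + h - l) \<odot> y = 0"
            using g ab cd h by (simp add: mul_linear algebra_simps)
          then have "k * k * g - l * k = 0 \<and> k * g + k * g + h - l = 0" by (rule indep2D[OF True])
          then have "k * (k * g - l) = 0" "h = l - (k * g + k * g)"
            by (simp_all add: right_diff_distrib ac_simps eq_diff_eq)
          then have "l = k * g" using that by simp
          then show ?thesis using \<open>h = _\<close> by simp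
        qed
        from this[of 1] this[of 2] show False using \<open>g \<noteq> 0\<close> by simp
      qed
      then show ?thesis using ab by auto
    qed
    then show ?thesis by (rule perm_if_mul_scales_left)
  qed
qed

end

section \<open>Perm algebras and Fitting's lemma\<close>

locale perm_algebra3 = algebra3 +
  assumes assoc: "x \<cdot> y \<cdot> z = x \<cdot> (y \<cdot> z)"
    and right_comm: "x \<cdot> y \<cdot> z = x \<cdot> z \<cdot> y"
begin

text \<open>A product is determined by its first factor and the multiset of the others, so ordered
  rewriting with the following rules normalises words.\<close>

lemmas word_simps = assoc[symmetric] right_comm

text \<open>Fitting's lemma for left multiplication by \<open>x\<close>: for the least \<open>k\<close> such that \<open>x ^ k\<close> occurs
  in a linear relation among the powers of \<open>x\<close>, that relation reads \<open>x ^ k = x ^ k \<cdot> u\<close>.\<close>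

lemma fitting:
  obtains (nilpotent) "x \<cdot> x \<cdot> x \<cdot> x = 0"
  | (idempotent) u p q r where "u = p \<odot> x + q \<odot> (x \<cdot> x) + r \<odot> (x \<cdot> x \<cdot> x)"
      "u \<cdot> u \<cdot> u \<cdot> u = u \<cdot> u \<cdot> u" "u \<cdot> u \<cdot> u \<noteq> 0"
proof (cases "x \<cdot> x \<cdot> x \<cdot> x = 0")
  case True
  then show thesis by (rule nilpotent)
next
  case False
  obtain a b c d where rel: "a \<odot> x + b \<odot> (x \<cdot> x) + c \<odot> (x \<cdot> x \<cdot> x) + d \<odot> (x \<cdot> x \<cdot> x \<cdot> x) = 0"
    and nz: "a \<noteq> 0 \<or> b \<noteq> 0 \<or> c \<noteq> 0 \<or> d \<noteq> 0"
    by (rule dependent4)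
  \<comment> \<open>When the relation starts at \<open>x\<close> or \<open>x \<cdot> x\<close>, it
    is multiplied up so that all cases end in one identity at the third power. A relation with only
    \<open>d\<close> nonzero would give a vanishing fourth power.\<close>
  have "\<exists>p q r. x \<cdot> x \<cdot> x \<cdot> (p \<odot> x + q \<odot> (x \<cdot> x) + r \<odot> (x \<cdot> x \<cdot> x)) = x \<cdot> x \<cdot> x"
  proof -
    have div: "y = (- (1 / k)) \<odot> z" if "k \<odot> y + z = 0" "k \<noteq> 0" for k y z
    proof -
      have "(1 / k) \<odot> (k \<odot> y + z) = 0" using that by simp
      then show ?thesis using that(2) by (simp add: scale_right_distrib eq_neg_iff_add_eq_0)
    qed
    consider "a \<noteq> 0" | "a = 0" "b \<noteq> 0" | "a = 0" "b = 0" "c \<noteq> 0" | "a = 0" "b = 0" "c = 0" "d \<noteq> 0"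
      using nz by blast
    then show ?thesis
    proof cases
      case 1
      have "x = (- (1 / a)) \<odot> (b \<odot> (x \<cdot> x) + c \<odot> (x \<cdot> x \<cdot> x) + d \<odot> (x \<cdot> x \<cdot> x \<cdot> x))"
        using rel 1 by (intro div) (simp_all add: add.assoc)
      then have "x \<cdot> (x \<cdot> x) = (- (1 / a)) \<odot> (b \<odot> (x \<cdot> x) + c \<odot> (x \<cdot> x \<cdot> x) + d \<odot> (x \<cdot> x \<cdot> x \<cdot> x)) \<cdot> (x \<cdot> x)"
        by (rule arg_cong[where f = "\<lambda>w. w \<cdot> (x \<cdot> x)"])
      then have "x \<cdot> x \<cdot> x \<cdot> ((- b / a) \<odot> x + (- c / a) \<odot> (x \<cdot> x) + (- d / a) \<odot> (x \<cdot> x \<cdot> x)) = x \<cdot> x \<cdot> x"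
        by (simp add: mul_linear word_simps)
      then show ?thesis by blast
    next
      case 2
      have "x \<cdot> x = (- (1 / b)) \<odot> (c \<odot> (x \<cdot> x \<cdot> x) + d \<odot> (x \<cdot> x \<cdot> x \<cdot> x))"
        using rel 2 by (intro div) (simp_all add: add.assoc)
      then have "x \<cdot> x \<cdot> x = (- (1 / b)) \<odot> (c \<odot> (x \<cdot> x \<cdot> x) + d \<odot> (x \<cdot> x \<cdot> x \<cdot> x)) \<cdot> x"
        by (rule arg_cong[where f = "\<lambda>w. w \<cdot> x"])
      then have "x \<cdot> x \<cdot> x \<cdot> ((- c / b) \<odot> x + (- d / b) \<odot> (x \<cdot> x) + 0 \<odot> (x \<cdot> x \<cdot> x)) = x \<cdot> x \<cdot> x"
        by (simp add: mul_linear word_simps)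
      then show ?thesis by blast
    next
      case 3
      have "x \<cdot> x \<cdot> x = (- (1 / c)) \<odot> (d \<odot> (x \<cdot> x \<cdot> x \<cdot> x))"
        using rel 3 by (intro div) simp_all
      then have "x \<cdot> x \<cdot> x \<cdot> ((- d / c) \<odot> x + 0 \<odot> (x \<cdot> x) + 0 \<odot> (x \<cdot> x \<cdot> x)) = x \<cdot> x \<cdot> x"
        by (simp add: mul_linear word_simps)
      then show ?thesis by blast
    next
      case 4
      then show ?thesis using rel False by simp
    qed
  qed
  then obtain p q r u where u: "u = p \<odot> x + q \<odot> (x \<cdot> x) + r \<odot> (x \<cdot> x \<cdot> x)"
    and "x \<cdot> x \<cdot> x \<cdot> u = x \<cdot> x \<cdot> x" by blast
  then have fix_u: "x \<cdot> u \<cdot> x \<cdot> x = x \<cdot> x \<cdot> x" by (simp add: right_comm)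
  \<comment> \<open>Each word in the expanded cube of \<open>u\<close> has at least three factors
    \<open>x\<close>, so right multiplication by \<open>u\<close> fixes it. It follows that the cube
    of \<open>u\<close> is idempotent.\<close>
  have "u \<cdot> u \<cdot> u = (p \<odot> x + q \<odot> (x \<cdot> x) + r \<odot> (x \<cdot> x \<cdot> x)) \<cdot> (p \<odot> x + q \<odot> (x \<cdot> x) + r \<odot> (x \<cdot> x \<cdot> x))
    \<cdot> (p \<odot> x + q \<odot> (x \<cdot> x) + r \<odot> (x \<cdot> x \<cdot> x))"
    by (simp only: u)
  also have "\<dots> \<cdot> u = \<dots>" by (simp add: mul_linear word_simps fix_u)
  finally have "u \<cdot> u \<cdot> u \<cdot> u = u \<cdot> u \<cdot> u" using u by metis
  moreover have "x \<cdot> x \<cdot> x \<cdot> (u \<cdot> u \<cdot> u) = x \<cdot> x \<cdot> x"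
    by (simp add: word_simps fix_u)
  then have "u \<cdot> u \<cdot> u \<noteq> 0" using False by auto
  ultimately show thesis by (rule idempotent[OF u])
qed

section \<open>Nil perm algebras\<close>

lemma iso_A06:
  assumes "x \<cdot> x \<cdot> x \<noteq> 0" "x \<cdot> x \<cdot> x \<cdot> x = 0"
  shows "algebra_isomorphic smul mul (*s) A06"
proof -
  have "indep3 x (x \<cdot> x) (x \<cdot> x \<cdot> x)"
  proof (unfold indep3_def, intro allI impI)
    fix a b c assume rel: "a \<odot> x + b \<odot> (x \<cdot> x) + c \<odot> (x \<cdot> x \<cdot> x) = 0"
    \<comment> \<open>Two left multiplications by \<open>x\<close> leave only the term with
      \<open>a\<close>; one then isolates \<open>b\<close>.\<close>
    then have "x \<cdot> (x \<cdot> (a \<odot> x + b \<odot> (x \<cdot> x) + c \<odot> (x \<cdot> x \<cdot> x))) = 0" by simp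
    then have [simp]: "a = 0" using assms by (simp add: mul_linear word_simps)
    from rel have "x \<cdot> (a \<odot> x + b \<odot> (x \<cdot> x) + c \<odot> (x \<cdot> x \<cdot> x)) = 0" by simp
    then have "b = 0" using assms by (simp add: mul_linear word_simps)
    then show "a = 0 \<and> b = 0 \<and> c = 0" using rel assms by simp
  qed
  then show ?thesis unfolding A06_def
    by (rule iso_table) (simp_all add: axis_def assms(2) word_simps)
qed

text \<open>Every triple product of \<open>x\<close> and \<open>y\<close> rearranges to one
  containing a square, hence vanishes. Multiplying a linear relation by \<open>x\<close> on the left
  and by \<open>y\<close> on the right therefore isolates its coefficients.\<close>

lemma iso_A12:
  assumes sq: "\<And>x. x \<cdot> x = 0" and "x \<cdot> y \<noteq> 0"
  shows "algebra_isomorphic smul mul (*s) A12"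
proof -
  have yx: "y \<cdot> x = - (x \<cdot> y)"
    using sq[of "x + y"] by (simp add: mul_linear sq[of x] sq[of y] eq_neg_iff_add_eq_0 add.commute)
  have words: "x \<cdot> y \<cdot> x = 0" "x \<cdot> y \<cdot> y = 0" "x \<cdot> (x \<cdot> y) = 0" "y \<cdot> (x \<cdot> y) = 0"
    using right_comm[of x y x] assoc[of x y y] assoc[of x x y] assoc[of y x y] right_comm[of y x y]
    by (simp_all add: sq)
  have "indep3 x y (x \<cdot> y)"
  proof (unfold indep3_def, intro allI impI)
    fix a b c assume rel: "a \<odot> x + b \<odot> y + c \<odot> (x \<cdot> y) = 0"
    then have "x \<cdot> (a \<odot> x + b \<odot> y + c \<odot> (x \<cdot> y)) = 0"
      "(a \<odot> x + b \<odot> y + c \<odot> (x \<cdot> y)) \<cdot> y = 0" by simp_all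
    then have "a = 0" "b = 0" using assms(2) by (simp_all add: mul_linear words sq)
    then show "a = 0 \<and> b = 0 \<and> c = 0" using rel assms(2) by simp
  qed
  then show ?thesis unfolding A12_def
    by (rule iso_table) (simp_all add: axis_def sq yx words)
qed

text \<open>If \<open>x \<cdot> x \<cdot> y \<noteq> 0\<close>, left multiplication by
  \<open>x\<close> is a nilpotent shift on the basis \<open>y\<close>, \<open>x \<cdot> y\<close>,
  \<open>x \<cdot> x \<cdot> y\<close>. As it kills \<open>x \<cdot> x\<close>, this square is a
  multiple of \<open>x \<cdot> x \<cdot> y\<close>; iterating this accumulates factors
  \<open>y\<close> until their cube appears.\<close>

lemma cube_zero_imp_triple_zero:
  assumes cube: "\<And>x. x \<cdot> x \<cdot> x = 0"
  shows "x \<cdot> y \<cdot> z = 0"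
proof -
  have xxy: "x \<cdot> x \<cdot> y = 0" for x y
  proof (rule ccontr)
    assume nz: "x \<cdot> x \<cdot> y \<noteq> 0"
    have words: "x \<cdot> (x \<cdot> y) = x \<cdot> x \<cdot> y" "x \<cdot> (x \<cdot> x \<cdot> y) = 0" "x \<cdot> (x \<cdot> x) = 0"
      using cube[of x] assoc[of x "x \<cdot> x" y] assoc[of x x x] by (simp_all add: assoc)
    have ind: "indep3 y (x \<cdot> y) (x \<cdot> x \<cdot> y)"
    proof (unfold indep3_def, intro allI impI)
      fix a b c assume rel: "a \<odot> y + b \<odot> (x \<cdot> y) + c \<odot> (x \<cdot> x \<cdot> y) = 0"
      then have "x \<cdot> (x \<cdot> (a \<odot> y + b \<odot> (x \<cdot> y) + c \<odot> (x \<cdot> x \<cdot> y))) = 0" by simp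
      then have [simp]: "a = 0" using nz by (simp add: mul_linear words)
      from rel have "x \<cdot> (a \<odot> y + b \<odot> (x \<cdot> y) + c \<odot> (x \<cdot> x \<cdot> y)) = 0" by simp
      then have "b = 0" using nz by (simp add: mul_linear words)
      then show "a = 0 \<and> b = 0 \<and> c = 0" using rel nz by simp
    qed
    obtain a b c where xx: "x \<cdot> x = a \<odot> y + b \<odot> (x \<cdot> y) + c \<odot> (x \<cdot> x \<cdot> y)"
      by (rule indep3_spans[OF ind])
    then have "x \<cdot> (x \<cdot> x) = x \<cdot> (a \<odot> y + b \<odot> (x \<cdot> y) + c \<odot> (x \<cdot> x \<cdot> y))" by simp
    then have "0 \<odot> y + a \<odot> (x \<cdot> y) + b \<odot> (x \<cdot> x \<cdot> y) = 0"
      by (simp add: mul_linear words)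
    then have "a = 0" "b = 0" using indep3D[OF ind] by blast+
    then have xx': "x \<cdot> x = c \<odot> (x \<cdot> x \<cdot> y)" using xx by simp
    have "x \<cdot> x \<cdot> y \<cdot> y \<cdot> y = 0"
      using cube[of y] by (simp add: assoc)
    have step: "x \<cdot> x \<cdot> v = c \<odot> (x \<cdot> x \<cdot> y \<cdot> v)" for v
      by (subst xx') (simp only: mul_scale_left)
    have "x \<cdot> x \<cdot> y = c \<odot> (x \<cdot> x \<cdot> y \<cdot> y)" by (rule step)
    moreover have "x \<cdot> x \<cdot> y \<cdot> y = c \<odot> (x \<cdot> x \<cdot> y \<cdot> y \<cdot> y)"
      using step[of "y \<cdot> y"] unfolding assoc .
    ultimately have "x \<cdot> x \<cdot> y = 0" using \<open>x \<cdot> x \<cdot> y \<cdot> y \<cdot> y = 0\<close> by simp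
    then show False using nz by simp
  qed
  have anti: "x \<cdot> y \<cdot> z = - (y \<cdot> x \<cdot> z)" for x y z
    using xxy[of "x + y" z] by (simp add: mul_linear xxy eq_neg_iff_add_eq_0 add.commute)
  \<comment> \<open>A triple product is antisymmetric in its first two and symmetric in its last two
    arguments. Alternating these swaps returns to the same product with the opposite sign.\<close>
  have "x \<cdot> y \<cdot> z = - (x \<cdot> y \<cdot> z)"
    by (metis anti right_comm minus_minus)
  then have "2 \<odot> (x \<cdot> y \<cdot> z) = 0"
    by (metis eq_neg_iff_add_eq_0 scale_left_distrib scale_one one_add_one)
  then show ?thesis by simp
qed

text \<open>All products lie on the line of \<open>w\<close> and \<open>w\<close> annihilates
  everything. What remains is a bilinear form on the plane of \<open>x\<close> and \<open>y\<close>
  with matrix rows \<open>1, b\<close> and \<open>b', d\<close>.\<close>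

lemma nilpotent_classification_square:
  assumes triple: "\<And>x y z. x \<cdot> y \<cdot> z = 0" and "x \<cdot> x \<noteq> 0"
  shows "\<exists>B \<in> {A04, A05, A13} \<union> {A14 \<alpha> | \<alpha>. \<alpha> \<noteq> 0}. algebra_isomorphic smul mul (*s) B"
proof -
  define w where "w = x \<cdot> x"
  have w0: "w \<noteq> 0" using assms(2) by (simp add: w_def)
  have triple': "x \<cdot> (y \<cdot> z) = 0" for x y z using triple[of x y z] by (simp add: assoc)
  have ann [simp]: "v \<cdot> w = 0" "w \<cdot> v = 0" for v by (simp_all add: w_def triple triple')
  have xx: "x \<cdot> x = w" by (simp add: w_def)
  have "indep2 x w"
  proof (unfold indep2_def, intro allI impI)
    fix a b assume rel: "a \<odot> x + b \<odot> w = 0"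
    then have "x \<cdot> (a \<odot> x + b \<odot> w) = 0" by simp
    then have "a = 0" using w0 by (simp add: mul_linear xx)
    then show "a = 0 \<and> b = 0" using rel w0 by simp
  qed
  then obtain y where ind: "indep3 x w y" using exists_indep3[of UNIV x w] by auto
  text \<open>If \<open>c\<close> is the \<open>y\<close>-coefficient of \<open>x \<cdot> y\<close>, then \<open>x \<cdot> (x \<cdot> y) = 0\<close> puts \<open>c (x \<cdot> y)\<close> into the line of
    \<open>w\<close>, so \<open>c = 0\<close>.\<close>
  have xy: "\<exists>b. x \<cdot> y = b \<odot> w"
  proof -
    obtain a b c where 1: "x \<cdot> y = a \<odot> x + b \<odot> w + c \<odot> y" by (rule indep3_spans[OF ind])
    have "x \<cdot> (a \<odot> x + b \<odot> w + c \<odot> y) = 0" using triple'[of x x y] 1 by simp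
    then have "(c * a) \<odot> x + (a + c * b) \<odot> w + (c * c) \<odot> y = 0"
      by (simp add: mul_linear xx 1 algebra_simps)
    then have "c * a = 0 \<and> a + c * b = 0 \<and> c * c = 0" by (rule indep3D[OF ind])
    then show ?thesis using 1 by auto
  qed
  have yx: "\<exists>b. y \<cdot> x = b \<odot> w"
  proof -
    obtain a b c where 1: "y \<cdot> x = a \<odot> x + b \<odot> w + c \<odot> y" by (rule indep3_spans[OF ind])
    have "(a \<odot> x + b \<odot> w + c \<odot> y) \<cdot> x = 0" using triple[of y x x] 1 by simp
    then have "(c * a) \<odot> x + (a + c * b) \<odot> w + (c * c) \<odot> y = 0"
      by (simp add: mul_linear xx 1 algebra_simps)
    then have "c * a = 0 \<and> a + c * b = 0 \<and> c * c = 0" by (rule indep3D[OF ind])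
    then show ?thesis using 1 by auto
  qed
  from xy obtain b where b: "x \<cdot> y = b \<odot> w" by blast
  from yx obtain b' where b': "y \<cdot> x = b' \<odot> w" by blast
  obtain d where d: "y \<cdot> y = d \<odot> w"
  proof -
    obtain a k c where 1: "y \<cdot> y = a \<odot> x + k \<odot> w + c \<odot> y" by (rule indep3_spans[OF ind])
    have "y \<cdot> (a \<odot> x + k \<odot> w + c \<odot> y) = 0" using triple'[of y y y] 1 by simp
    then have "(c * a) \<odot> x + (a * b' + c * k) \<odot> w + (c * c) \<odot> y = 0"
      by (simp add: mul_linear b' 1 algebra_simps)
    then have "c * a = 0 \<and> a * b' + c * k = 0 \<and> c * c = 0" by (rule indep3D[OF ind])
    then have "c = 0" by simp
    have "x \<cdot> (a \<odot> x + k \<odot> w + c \<odot> y) = 0" using triple'[of x y y] 1 by simp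
    then have "a = 0" using w0 \<open>c = 0\<close> by (simp add: mul_linear xx)
    then show thesis using that[of k] 1 \<open>c = 0\<close> by simp
  qed
  \<comment> \<open>This is the discriminant of the square of \<open>t \<odot> x + y\<close>, a
    quadratic polynomial in \<open>t\<close> times \<open>w\<close>.\<close>
  define D where "D = (b + b')\<^sup>2 - 4 * d"
  show ?thesis
  proof (cases "D = 0")
    case True
    \<comment> \<open>The double root gives the null vector \<open>z\<close>, and \<open>k\<close>
      is the antisymmetric part of the form. If \<open>k\<close> is nonzero, it is scaled to
      one.\<close>
    define z where "z = y - ((b + b') / 2) \<odot> x"
    define k where "k = (b - b') / 2"
    have d': "d = (b + b')\<^sup>2 / 4" using True by (simp add: D_def)
    have zz: "z \<cdot> z = 0"
    proof -
      have "z \<cdot> z = (d - (b + b') / 2 * b - (b + b') / 2 * b' + (b + b') / 2 * ((b + b') / 2)) \<odot> w"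
        by (simp add: z_def mul_linear xx b b' d scale_left_distrib scale_left_diff_distrib)
      also have "d - (b + b') / 2 * b - (b + b') / 2 * b' + (b + b') / 2 * ((b + b') / 2) = 0"
        by (simp add: d' power2_eq_square field_simps)
      finally show ?thesis by simp
    qed
    have xz: "x \<cdot> z = k \<odot> w"
    proof -
      have "x \<cdot> z = (b - (b + b') / 2) \<odot> w"
        by (simp add: z_def mul_linear xx b scale_left_diff_distrib)
      also have "b - (b + b') / 2 = k" by (simp add: k_def field_simps)
      finally show ?thesis .
    qed
    have zx: "z \<cdot> x = - (k \<odot> w)"
    proof -
      have "z \<cdot> x = (b' - (b + b') / 2) \<odot> w"
        by (simp add: z_def mul_linear xx b' scale_left_diff_distrib)
      also have "b' - (b + b') / 2 = - k" by (simp add: k_def field_simps)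
      finally show ?thesis by simp
    qed
    have ind': "indep3 x w (h \<odot> z)" if "h \<noteq> 0" for h
    proof (unfold indep3_def, intro allI impI)
      fix p q r assume "p \<odot> x + q \<odot> w + r \<odot> h \<odot> z = 0"
      then have "(p - r * h * ((b + b') / 2)) \<odot> x + q \<odot> w + (r * h) \<odot> y = 0"
        by (simp add: z_def mul_linear algebra_simps)
      then have "p - r * h * ((b + b') / 2) = 0 \<and> q = 0 \<and> r * h = 0" by (rule indep3D[OF ind])
      then show "p = 0 \<and> q = 0 \<and> r = 0" using that by auto
    qed
    show ?thesis
    proof (cases "k = 0")
      case True
      have "algebra_isomorphic smul mul (*s) A04" unfolding A04_def
        by (rule iso_table[OF ind'[of 1]]) (simp_all add: axis_def xx xz zx zz True)
      then show ?thesis by blast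
    next
      case False
      have "algebra_isomorphic smul mul (*s) A13" unfolding A13_def
        by (rule iso_table[OF ind'[of "1 / k"]])
          (simp_all add: axis_def xx xz zx zz False mul_linear)
      then show ?thesis by blast
    qed
  next
    case False
    define s where "s = csqrt D"
    have s: "s * s = D" "s \<noteq> 0" using False by (simp_all add: s_def flip: power2_eq_square)
    \<comment> \<open>The two roots give two independent null vectors.\<close>
    define p q where "p = ((- (b + b') + s) / 2) \<odot> x + y" and "q = ((- (b + b') - s) / 2) \<odot> x + y"
    define m n where "m = (- D - s * (b' - b)) / 2" and "n = (- D + s * (b' - b)) / 2"
    have d': "d = ((b + b')\<^sup>2 - s * s) / 4" by (simp add: s D_def)
    have prods: "p \<cdot> p = 0" "q \<cdot> q = 0" "p \<cdot> q = m \<odot> w" "q \<cdot> p = n \<odot> w"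
    proof -
      have gen: "(r \<odot> x + y) \<cdot> (t \<odot> x + y) = (r * t + r * b + t * b' + d) \<odot> w" for r t
        by (simp add: mul_linear xx b b' d scale_left_distrib algebra_simps)
      show "p \<cdot> p = 0" "q \<cdot> q = 0" "p \<cdot> q = m \<odot> w" "q \<cdot> p = n \<odot> w"
        unfolding p_def q_def gen m_def n_def s(1)[symmetric] d'
        by (simp_all add: power2_eq_square field_simps)
    qed
    have mn: "m + n \<noteq> 0" using False by (simp add: m_def n_def add_divide_distrib[symmetric])
    \<comment> \<open>The third basis vector is the mean of \<open>p \<cdot> q\<close> and
      \<open>q \<cdot> p\<close>, so that these products become \<open>1 + \<alpha>\<close> and
      \<open>1 - \<alpha>\<close> times it. It is nonzero because
      \<open>m + n = - D\<close>.\<close>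
    define e where "e = ((m + n) / 2) \<odot> w"
    have ann': "e \<cdot> v = 0" "v \<cdot> e = 0" for v by (simp_all add: e_def mul_linear)
    have ind': "indep3 p q e"
    proof (unfold indep3_def, intro allI impI)
      fix f g h assume "f \<odot> p + g \<odot> q + h \<odot> e = 0"
      then have "(f * ((- (b + b') + s) / 2) + g * ((- (b + b') - s) / 2)) \<odot> x
          + (h * ((m + n) / 2)) \<odot> w + (f + g) \<odot> y = 0"
        by (simp add: p_def q_def e_def mul_linear scale_left_distrib add_ac)
      then have *: "f * ((- (b + b') + s) / 2) + g * ((- (b + b') - s) / 2) = 0
          \<and> h * ((m + n) / 2) = 0 \<and> f + g = 0" by (rule indep3D[OF ind])
      then have "g = - f" by (simp add: eq_neg_iff_add_eq_0 add.commute)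
      with * have "f * s = 0" by (simp add: field_simps)
      then show "f = 0 \<and> g = 0 \<and> h = 0" using * mn s \<open>g = - f\<close> by auto
    qed
    define \<alpha> where "\<alpha> = (m - n) / (m + n)"
    have "1 + \<alpha> = 2 * m / (m + n)" "1 - \<alpha> = 2 * n / (m + n)"
      using mn by (simp_all add: \<alpha>_def field_simps)
    then have al: "(1 + \<alpha>) \<odot> e = m \<odot> w" "(1 - \<alpha>) \<odot> e = n \<odot> w"
      using mn by (simp_all add: e_def)
    show ?thesis
    proof (cases "\<alpha> = 0")
      case True
      then have "m \<odot> w = e" "n \<odot> w = e" using al by auto
      then have "algebra_isomorphic smul mul (*s) A05" unfolding A05_def
        by (intro iso_table[OF ind']) (simp_all add: axis_def prods ann')
      then show ?thesis by blast
    next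
      case False
      have "algebra_isomorphic smul mul (*s) (A14 \<alpha>)" unfolding A14_def
        by (rule iso_table[OF ind']) (simp_all add: axis_def prods ann' al)
      then show ?thesis using False by blast
    qed
  qed
qed

lemma nilpotent_classification:
  assumes nil: "\<And>x. x \<cdot> x \<cdot> x \<cdot> x = 0" and "x \<cdot> y \<noteq> 0"
  shows "\<exists>B \<in> {A04, A05, A06, A12, A13} \<union> {A14 \<alpha> | \<alpha>. \<alpha> \<noteq> 0}.
    algebra_isomorphic smul mul (*s) B"
proof (cases "\<forall>x. x \<cdot> x \<cdot> x = 0")
  case False
  then show ?thesis using iso_A06 nil by blast
next
  case True
  then have triple: "x \<cdot> y \<cdot> z = 0" for x y z
    using cube_zero_imp_triple_zero by simp
  show ?thesis
  proof (cases "\<forall>x. x \<cdot> x = 0")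
    case True
    then show ?thesis using iso_A12 assms(2) by blast
  next
    case False
    then show ?thesis using nilpotent_classification_square[OF triple] by blast
  qed
qed

end

section \<open>Peirce components and pairs of orthogonal idempotents\<close>

context perm_algebra3
begin

lemma idempotent_mul:
  assumes "e \<cdot> e = e"
  shows "e \<cdot> (e \<cdot> x) = e \<cdot> x" "e \<cdot> x \<cdot> e = e \<cdot> x" "x \<cdot> e \<cdot> e = x \<cdot> e" "e \<cdot> (x \<cdot> e) = e \<cdot> x"
proof -
  show 1: "e \<cdot> (e \<cdot> x) = e \<cdot> x" using assms by (metis assoc)
  show 2: "e \<cdot> x \<cdot> e = e \<cdot> x" using assms by (metis right_comm)
  show "x \<cdot> e \<cdot> e = x \<cdot> e" using assms by (metis assoc)
  show "e \<cdot> (x \<cdot> e) = e \<cdot> x" using 2 by (metis assoc)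
qed

text \<open>\<open>peirce11\<close>, \<open>peirce01\<close> and \<open>peirce00\<close> are the Peirce components of the idempotent \<open>e\<close>,
  indexed by the eigenvalues of left and right multiplication by \<open>e\<close>. In a perm algebra the
  component \<open>10\<close> is zero because \<open>e \<cdot> x \<cdot> e = e \<cdot> x\<close>.\<close>

definition peirce11 :: "'a \<Rightarrow> 'a \<Rightarrow> bool" where
  "peirce11 e y \<longleftrightarrow> e \<cdot> y = y \<and> y \<cdot> e = y"

definition peirce01 :: "'a \<Rightarrow> 'a \<Rightarrow> bool" where
  "peirce01 e y \<longleftrightarrow> e \<cdot> y = 0 \<and> y \<cdot> e = y"

definition peirce00 :: "'a \<Rightarrow> 'a \<Rightarrow> bool" where
  "peirce00 e y \<longleftrightarrow> e \<cdot> y = 0 \<and> y \<cdot> e = 0"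

lemmas peirce_defs = peirce11_def peirce01_def peirce00_def

text \<open>The perm identity interchanges the last two factors of
  \<open>v \<cdot> (y \<cdot> e)\<close>, and \<open>e \<cdot> y = 0\<close>.\<close>

lemma peirce01_left_zero:
  assumes "peirce01 e y"
  shows "v \<cdot> y = 0"
proof -
  have "v \<cdot> y = v \<cdot> (y \<cdot> e)" using assms by (simp add: peirce01_def)
  also have "\<dots> = v \<cdot> (e \<cdot> y)" using assoc right_comm by metis
  finally show ?thesis using assms by (simp add: peirce01_def)
qed

text \<open>Write \<open>x\<close> as \<open>x \<cdot> e\<close> and move the factor
  \<open>e\<close> next to \<open>y\<close>.\<close>

lemma peirce_mult_zero:
  assumes "peirce11 e x \<or> peirce01 e x" "peirce00 e y"
  shows "x \<cdot> y = 0" "y \<cdot> x = 0"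
proof -
  have "x \<cdot> y = x \<cdot> e \<cdot> y" using assms by (auto simp: peirce_defs)
  also have "\<dots> = x \<cdot> (e \<cdot> y)" by (rule assoc)
  finally show "x \<cdot> y = 0" using assms by (simp add: peirce_defs)
  have "y \<cdot> x = y \<cdot> (x \<cdot> e)" using assms by (auto simp: peirce_defs)
  also have "\<dots> = y \<cdot> e \<cdot> x" using assoc right_comm by metis
  finally show "y \<cdot> x = 0" using assms by (simp add: peirce_defs)
qed

text \<open>Each \<open>x\<close> is a sum of five vectors of the required types, so one of these
  types supplies \<open>z\<close>. The type for \<open>f\<close> is recorded only in component
  \<open>00\<close> of \<open>e\<close>: in the others \<open>peirce_mult_zero\<close> already gives
  the products with \<open>f\<close>, which lies in \<open>00\<close> itself.\<close>

lemma two_idempotents_extend: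
  assumes e: "e \<cdot> e = e" and f: "f \<cdot> f = f" and orth: "e \<cdot> f = 0" "f \<cdot> e = 0" and "indep2 e f"
  obtains z where "indep3 e f z"
    "peirce11 e z \<or> peirce01 e z \<or> peirce00 e z \<and> (peirce11 f z \<or> peirce01 f z \<or> peirce00 f z)"
proof -
  define P where "P = {z. peirce11 e z \<or> peirce01 e z \<or>
    peirce00 e z \<and> (peirce11 f z \<or> peirce01 f z \<or> peirce00 f z)}"
  have "x \<in> span P" for x
  proof -
    have xef: "x \<cdot> e \<cdot> f = 0" "x \<cdot> f \<cdot> e = 0" by (simp_all add: assoc orth)
    have ef: "e \<cdot> (f \<cdot> x) = 0" "e \<cdot> (x \<cdot> f) = 0" "f \<cdot> x \<cdot> e = 0" "f \<cdot> (x \<cdot> e) = 0"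
      using assoc right_comm orth by (metis mul_zero_left)+
    note rules = idempotent_mul[OF e] idempotent_mul[OF f] xef ef
    have "peirce11 e (e \<cdot> x)" "peirce01 e (x \<cdot> e - e \<cdot> x)" "peirce00 e (f \<cdot> x)" "peirce11 f (f \<cdot> x)"
      "peirce00 e (x \<cdot> f - f \<cdot> x)" "peirce01 f (x \<cdot> f - f \<cdot> x)"
      "peirce00 e (x - x \<cdot> e - x \<cdot> f)" "peirce00 f (x - x \<cdot> e - x \<cdot> f)"
      by (simp_all add: peirce_defs mul_linear rules)
    then have "e \<cdot> x \<in> P" "x \<cdot> e - e \<cdot> x \<in> P" "f \<cdot> x \<in> P" "x \<cdot> f - f \<cdot> x \<in> P" "x - x \<cdot> e - x \<cdot> f \<in> P"
      by (auto simp: P_def)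
    then have "e \<cdot> x + (x \<cdot> e - e \<cdot> x) + f \<cdot> x + (x \<cdot> f - f \<cdot> x) + (x - x \<cdot> e - x \<cdot> f) \<in> span P"
      by (intro span_add span_base)
    then show ?thesis by simp
  qed
  then have "span P = UNIV" by auto
  then obtain z where "z \<in> P" "indep3 e f z" using exists_indep3 assms(5) by blast
  then show thesis using that by (auto simp: P_def)
qed

text \<open>Here \<open>e\<close> and \<open>z\<close> span a plane algebra with unit
  \<open>e\<close>, given by one quadratic equation for \<open>z\<close>. A double root yields a
  nilpotent (\<open>A08\<close>); distinct roots split \<open>e\<close> into two idempotents
  (\<open>A07\<close>).\<close>

lemma iso_two_idempotents_11:
  assumes e: "e \<cdot> e = e" and f: "f \<cdot> f = f" and orth: "e \<cdot> f = 0" "f \<cdot> e = 0"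
    and ind: "indep3 e f z" and z: "peirce11 e z"
  shows "\<exists>B \<in> {A07, A08}. algebra_isomorphic smul mul (*s) B"
proof -
  have ez: "e \<cdot> z = z" "z \<cdot> e = z" using z by (simp_all add: peirce11_def)
  have "peirce00 e f" using orth by (simp add: peirce00_def)
  then have fz: "f \<cdot> z = 0" "z \<cdot> f = 0" using peirce_mult_zero z by blast+
  obtain a b c where zz: "z \<cdot> z = a \<odot> e + b \<odot> f + c \<odot> z" by (rule indep3_spans[OF ind])
  have "f \<cdot> (z \<cdot> z) = 0" using fz by (simp add: assoc[symmetric])
  then have "b \<odot> f = 0" by (simp add: zz mul_linear orth f fz)
  then have zz: "z \<cdot> z = a \<odot> e + c \<odot> z" using zz by simp
  have shift: "(z - k \<odot> e) \<cdot> (z - k \<odot> e) = (a + k * k) \<odot> e + (c - k - k) \<odot> z" for k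
  proof -
    have "(2 * k) \<odot> z = k \<odot> z + k \<odot> z" by (simp flip: scale_left_distrib)
    then show ?thesis
      by (simp add: mul_linear zz ez e scale_left_distrib scale_left_diff_distrib)
  qed
  define D where "D = c\<^sup>2 + 4 * a"
  show ?thesis
  proof (cases "D = 0")
    case True
    define t where "t = z - (c / 2) \<odot> e"
    have et: "e \<cdot> t = t" "t \<cdot> e = t" "f \<cdot> t = 0" "t \<cdot> f = 0"
      by (simp_all add: t_def mul_linear ez fz orth e)
    have "t \<cdot> t = (a + c / 2 * (c / 2)) \<odot> e + (c - c / 2 - c / 2) \<odot> z"
      unfolding t_def by (rule shift)
    moreover have "a + c / 2 * (c / 2) = 0" using True by (simp add: D_def power2_eq_square field_simps)
    ultimately have tt: "t \<cdot> t = 0" by simp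
    have ind': "indep3 f e t"
    proof (unfold indep3_def, intro allI impI)
      fix p q r assume "p \<odot> f + q \<odot> e + r \<odot> t = 0"
      then have "(q - r * (c / 2)) \<odot> e + p \<odot> f + r \<odot> z = 0"
        by (simp add: t_def mul_linear algebra_simps)
      then show "p = 0 \<and> q = 0 \<and> r = 0" using indep3D[OF ind] by fastforce
    qed
    have "algebra_isomorphic smul mul (*s) A08" unfolding A08_def
      by (rule iso_table[OF ind']) (simp_all add: axis_def e f orth et tt)
    then show ?thesis by blast
  next
    case False
    define s where "s = csqrt D"
    have s: "s * s = D" "s \<noteq> 0" using False by (simp_all add: s_def flip: power2_eq_square)
    \<comment> \<open>With the roots \<open>(c + s) / 2\<close> and \<open>(c - s) / 2\<close> of
      the equation of \<open>z\<close>, whose difference is \<open>s\<close>, this is the Lagrange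
      idempotent for the first root.\<close>
    define g where "g = (1 / s) \<odot> (z - ((c - s) / 2) \<odot> e)"
    have eg: "e \<cdot> g = g" "g \<cdot> e = g" "f \<cdot> g = 0" "g \<cdot> f = 0"
      by (simp_all add: g_def mul_linear ez fz orth e)
    have a: "a = (s * s - c * c) / 4" using s(1) by (simp add: D_def power2_eq_square field_simps)
    have "(z - ((c - s) / 2) \<odot> e) \<cdot> (z - ((c - s) / 2) \<odot> e)
        = (a + (c - s) / 2 * ((c - s) / 2)) \<odot> e + (c - (c - s) / 2 - (c - s) / 2) \<odot> z"
      by (rule shift)
    also have "a + (c - s) / 2 * ((c - s) / 2) = - (s * ((c - s) / 2))"
      by (simp add: a field_simps)
    also have "c - (c - s) / 2 - (c - s) / 2 = s" by (simp add: field_simps)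
    also have "- (s * ((c - s) / 2)) \<odot> e + s \<odot> z = s \<odot> (z - ((c - s) / 2) \<odot> e)"
      by (simp only: scale_right_diff_distrib scale_scale scale_minus_left) simp
    finally have gg: "g \<cdot> g = g" using s(2) by (simp add: g_def mul_scale_left mul_scale_right)
    have ind': "indep3 f g (e - g)"
    proof (unfold indep3_def, intro allI impI)
      fix p q r assume "p \<odot> f + q \<odot> g + r \<odot> (e - g) = 0"
      moreover have "p \<odot> f + q \<odot> g + r \<odot> (e - g) =
          (r - (q - r) * (1 / s * ((c - s) / 2))) \<odot> e + p \<odot> f + ((q - r) * (1 / s)) \<odot> z"
        unfolding g_def
        by (simp only: scale_right_diff_distrib scale_left_diff_distrib scale_scale left_diff_distrib)
          (simp only: algebra_simps)
      ultimately have "(r - (q - r) * (1 / s * ((c - s) / 2))) \<odot> e + p \<odot> f + ((q - r) * (1 / s)) \<odot> z = 0"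
        by simp
      then have "r - (q - r) * (1 / s * ((c - s) / 2)) = 0 \<and> p = 0 \<and> (q - r) * (1 / s) = 0"
        by (rule indep3D[OF ind])
      then show "p = 0 \<and> q = 0 \<and> r = 0" using s(2) by auto
    qed
    have "algebra_isomorphic smul mul (*s) A07" unfolding A07_def
      by (rule iso_table[OF ind']) (simp_all add: axis_def mul_linear e f orth eg gg)
    then show ?thesis by blast
  qed
qed

lemma iso_two_idempotents_01:
  assumes e: "e \<cdot> e = e" and f: "f \<cdot> f = f" and orth: "e \<cdot> f = 0" "f \<cdot> e = 0"
    and ind: "indep3 e f z" and z: "peirce01 e z"
  shows "algebra_isomorphic smul mul (*s) A24"
proof -
  have "peirce00 e f" using orth by (simp add: peirce00_def)
  then have "z \<cdot> f = 0" using peirce_mult_zero(1)[of e z f] z by blast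
  moreover have "z \<cdot> e = z" using z by (simp add: peirce01_def)
  ultimately show ?thesis unfolding A24_def
    by (intro iso_table[OF ind]) (simp_all add: axis_def e f orth peirce01_left_zero[OF z])
qed

lemma iso_two_idempotents_00:
  assumes e: "e \<cdot> e = e" and f: "f \<cdot> f = f" and orth: "e \<cdot> f = 0" "f \<cdot> e = 0"
    and ind: "indep3 e f z" and z: "peirce00 e z" "peirce00 f z"
  shows "\<exists>B \<in> {A01, A07}. algebra_isomorphic smul mul (*s) B"
proof -
  have prods: "e \<cdot> z = 0" "z \<cdot> e = 0" "f \<cdot> z = 0" "z \<cdot> f = 0" using z by (simp_all add: peirce00_def)
  have nz: "e \<noteq> 0" "f \<noteq> 0"
    using indep2_imp_nonzero[OF indep3_imp_indep2] ind indep3_swap12 by blast+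
  obtain a b c where zz: "z \<cdot> z = a \<odot> e + b \<odot> f + c \<odot> z" by (rule indep3_spans[OF ind])
  have "e \<cdot> (z \<cdot> z) = 0" "f \<cdot> (z \<cdot> z) = 0" using prods by (simp_all add: assoc[symmetric])
  then have "a = 0" "b = 0" using nz by (simp_all add: zz mul_linear e f orth prods)
  then have zz: "z \<cdot> z = c \<odot> z" using zz by simp
  show ?thesis
  proof (cases "c = 0")
    case True
    have "algebra_isomorphic smul mul (*s) A01" unfolding A01_def
      by (rule iso_table[OF ind]) (simp_all add: axis_def e f orth prods zz True)
    then show ?thesis by blast
  next
    case False
    \<comment> \<open>The rescaled \<open>z\<close> is a third orthogonal idempotent.\<close>
    have ind': "indep3 e f ((1 / c) \<odot> z)"
    proof (unfold indep3_def, intro allI impI)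
      fix p q r assume "p \<odot> e + q \<odot> f + r \<odot> (1 / c) \<odot> z = 0"
      then have "p \<odot> e + q \<odot> f + (r * (1 / c)) \<odot> z = 0" by simp
      then have "p = 0 \<and> q = 0 \<and> r * (1 / c) = 0" by (rule indep3D[OF ind])
      then show "p = 0 \<and> q = 0 \<and> r = 0" using False by simp
    qed
    have "algebra_isomorphic smul mul (*s) A07" unfolding A07_def
      by (rule iso_table[OF ind']) (simp_all add: axis_def mul_linear e f orth prods zz False)
    then show ?thesis by blast
  qed
qed

lemma two_idempotents_classification:
  assumes e: "e \<cdot> e = e" "e \<noteq> 0" and f: "f \<cdot> f = f" "f \<noteq> 0" and orth: "e \<cdot> f = 0" "f \<cdot> e = 0"
  shows "\<exists>B \<in> {A01, A07, A08, A24}. algebra_isomorphic smul mul (*s) B"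
proof -
  have ind: "indep2 e f"
  proof (unfold indep2_def, intro allI impI)
    fix a b assume "a \<odot> e + b \<odot> f = 0"
    then have "e \<cdot> (a \<odot> e + b \<odot> f) = 0" "f \<cdot> (a \<odot> e + b \<odot> f) = 0" by simp_all
    then show "a = 0 \<and> b = 0" using e f by (simp add: mul_linear orth)
  qed
  obtain z where z: "indep3 e f z"
    "peirce11 e z \<or> peirce01 e z \<or> peirce00 e z \<and> (peirce11 f z \<or> peirce01 f z \<or> peirce00 f z)"
    by (rule two_idempotents_extend[OF e(1) f(1) orth ind])
  \<comment> \<open>Types \<open>11\<close> and \<open>01\<close> for \<open>f\<close> are treated
    by exchanging \<open>e\<close> and \<open>f\<close>.\<close>
  note ind' = indep3_swap12[OF z(1)]
  consider "peirce11 e z" | "peirce01 e z" | "peirce11 f z" | "peirce01 f z"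
    | "peirce00 e z" "peirce00 f z" using z(2) by blast
  then show ?thesis
  proof cases
    case 1
    then show ?thesis using iso_two_idempotents_11[OF e(1) f(1) orth z(1)] by blast
  next
    case 2
    then show ?thesis using iso_two_idempotents_01[OF e(1) f(1) orth z(1)] by blast
  next
    case 3
    then show ?thesis using iso_two_idempotents_11[OF f(1) e(1) orth(2,1) ind'] by blast
  next
    case 4
    then show ?thesis using iso_two_idempotents_01[OF f(1) e(1) orth(2,1) ind'] by blast
  next
    case 5
    then show ?thesis using iso_two_idempotents_00[OF e(1) f(1) orth z(1)] by blast
  qed
qed

end

section \<open>Eigenvectors in a Peirce component, and nil planes\<close>

context perm_algebra3
begin

lemma peirce_span:
  assumes e: "e \<cdot> e = e"
  shows "span {y. peirce11 e y \<or> peirce01 e y \<or> peirce00 e y} = UNIV" (is "span ?P = _")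
proof -
  have "x \<in> span ?P" for x
  proof -
    have "peirce11 e (e \<cdot> x)" "peirce01 e (x \<cdot> e - e \<cdot> x)" "peirce00 e (x - x \<cdot> e)"
      by (simp_all add: peirce_defs mul_linear idempotent_mul[OF e])
    then have "e \<cdot> x + (x \<cdot> e - e \<cdot> x) + (x - x \<cdot> e) \<in> span ?P"
      by (intro span_add span_base) auto
    then show ?thesis by simp
  qed
  then show ?thesis by auto
qed

text \<open>Dividing the polynomial relation by \<open>y - r\<close> for a root \<open>r\<close>
  leaves a cofactor \<open>v\<close> with \<open>y \<cdot> v = r \<odot> v\<close>. If
  \<open>v\<close> vanishes, \<open>y\<close> is a multiple of \<open>e\<close>, and
  \<open>e\<close> itself is an eigenvector.\<close>

lemma eigenvector_if_quadratic:
  assumes e: "e \<cdot> e = e" "e \<noteq> 0" and y: "peirce11 e y"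
    and rel: "a \<odot> e + b \<odot> y + c \<odot> (y \<cdot> y) = 0" "a \<noteq> 0 \<or> b \<noteq> 0 \<or> c \<noteq> 0"
  shows "\<exists>l v. v \<noteq> 0 \<and> e \<cdot> v = v \<and> y \<cdot> v = l \<odot> v"
proof -
  have ye: "e \<cdot> y = y" "y \<cdot> e = y" using y by (simp_all add: peirce11_def)
  have line: ?thesis if "y = k \<odot> e" for k
    using that e by (intro exI[of _ k] exI[of _ e]) (simp add: mul_linear)
  show ?thesis
  proof (cases "c = 0")
    case True
    then have "b \<noteq> 0" using rel e by auto
    then have "\<not> indep2 e y" using indep2D[of e y a b] rel(1) True by auto
    then show ?thesis using not_indep2_nonzeroD[of e y] e line by blast
  next
    case False
    define r where "r = (- b + csqrt (b\<^sup>2 - 4 * a * c)) / (2 * c)"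
    have root: "a + b * r + c * r * r = 0"
    proof -
      define s where "s = csqrt (b\<^sup>2 - 4 * a * c)"
      have "s * s = b * b - 4 * a * c" by (simp add: s_def flip: power2_eq_square)
      moreover have "r = (- b + s) / (2 * c)" by (simp add: r_def s_def)
      then have "s = b + c * r * 2" using False by (simp add: field_simps)
      then have "4 * c * (a + b * r + c * r * r) = s * s - b * b + 4 * a * c"
        by (simp add: algebra_simps)
      ultimately show ?thesis using False by simp
    qed
    define v where "v = c \<odot> y + (c * r + b) \<odot> e"
    have "y \<cdot> v - r \<odot> v = (a \<odot> e + b \<odot> y + c \<odot> (y \<cdot> y)) - (a + b * r + c * r * r) \<odot> e"
      by (simp add: v_def mul_linear ye algebra_simps)
    then have yv: "y \<cdot> v = r \<odot> v" using rel(1) root by simp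
    have ev: "e \<cdot> v = v" by (simp add: v_def mul_linear ye e)
    show ?thesis
    proof (cases "v = 0")
      case True
      then have "\<not> indep2 e y" using indep2D[of e y "c * r + b" c] False
        by (auto simp: v_def add.commute)
      then show ?thesis using not_indep2_nonzeroD[of e y] e line by blast
    next
      case False
      then show ?thesis using yv ev by blast
    qed
  qed
qed

lemma eigenvector_exists:
  assumes e: "e \<cdot> e = e" "e \<noteq> 0" and y: "peirce11 e y"
  shows "\<exists>l v. v \<noteq> 0 \<and> e \<cdot> v = v \<and> y \<cdot> v = l \<odot> v"
proof -
  have ye: "e \<cdot> y = y" "y \<cdot> e = y" using y by (simp_all add: peirce11_def)
  obtain a b c d where rel: "a \<odot> e + b \<odot> y + c \<odot> (y \<cdot> y) + d \<odot> (y \<cdot> y \<cdot> y) = 0"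
    and nz: "a \<noteq> 0 \<or> b \<noteq> 0 \<or> c \<noteq> 0 \<or> d \<noteq> 0"
    by (rule dependent4)
  show ?thesis
  proof (cases "d = 0")
    case True
    then show ?thesis using eigenvector_if_quadratic[OF e y, of a b c] rel nz by simp
  next
    case False
    have "\<not> constant (poly [:a, b, c, d:])"
      using False by (simp add: constant_degree)
    then obtain r where "poly [:a, b, c, d:] r = 0"
      using fundamental_theorem_of_algebra by blast
    then have root: "a + b * r + c * r * r + d * r * r * r = 0" by (simp add: algebra_simps)
    \<comment> \<open>This is again the cofactor of \<open>y - r\<close>. If it vanishes, it is a
      quadratic relation with leading coefficient \<open>d \<noteq> 0\<close>.\<close>
    define v where "v = (d * r * r + c * r + b) \<odot> e + (d * r + c) \<odot> y + d \<odot> (y \<cdot> y)"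
    have "y \<cdot> v - r \<odot> v = (a \<odot> e + b \<odot> y + c \<odot> (y \<cdot> y) + d \<odot> (y \<cdot> y \<cdot> y))
        - (a + b * r + c * r * r + d * r * r * r) \<odot> e"
      by (simp add: v_def mul_linear ye assoc algebra_simps)
    then have yv: "y \<cdot> v = r \<odot> v" using rel root by simp
    have ev: "e \<cdot> v = v" using assoc[of e y y] by (simp add: v_def mul_linear ye e)
    show ?thesis
    proof (cases "v = 0")
      case True
      then show ?thesis using eigenvector_if_quadratic[OF e y _ disjI2[OF disjI2[OF False]]]
        unfolding v_def by blast
    next
      case False
      then show ?thesis using yv ev by blast
    qed
  qed
qed

text \<open>Take the last nonzero vector of the chain. The disjunction is kept so that properties
  preserved by left multiplication by \<open>y\<close> pass from \<open>v\<close> to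
  \<open>w\<close>.\<close>

lemma nilpotent_kernel:
  assumes "y \<cdot> y \<cdot> y \<cdot> y = 0" "v \<noteq> 0"
  obtains w where "w \<noteq> 0" "y \<cdot> w = 0" "w = v \<or> w = y \<cdot> v \<or> w = y \<cdot> (y \<cdot> v) \<or> w = y \<cdot> (y \<cdot> (y \<cdot> v))"
proof -
  have "y \<cdot> (y \<cdot> (y \<cdot> (y \<cdot> v))) = 0" using assms(1) by (metis assoc mul_zero_left)
  then show thesis using that assms(2) by metis
qed

text \<open>If all squares in the plane vanish, multiplying
  \<open>y \<cdot> z = b \<odot> y + c \<odot> z\<close> by \<open>y\<close> or \<open>z\<close>
  shows that it is zero. Otherwise some \<open>x\<close> has a nonzero square, and a nonzero cube
  would give three independent vectors in a plane.\<close>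

lemma nil_plane:
  assumes ind: "indep3 e y z"
    and closed: "\<exists>b c. y \<cdot> y = b \<odot> y + c \<odot> z" "\<exists>b c. y \<cdot> z = b \<odot> y + c \<odot> z"
      "\<exists>b c. z \<cdot> y = b \<odot> y + c \<odot> z" "\<exists>b c. z \<cdot> z = b \<odot> y + c \<odot> z"
    and nil: "\<And>b c x. x = b \<odot> y + c \<odot> z \<Longrightarrow> x \<cdot> x \<cdot> x \<cdot> x = 0"
  obtains (zero) "y \<cdot> y = 0" "y \<cdot> z = 0" "z \<cdot> y = 0" "z \<cdot> z = 0"
  | (cyclic) x b c where "x = b \<odot> y + c \<odot> z" "indep3 e x (x \<cdot> x)" "x \<cdot> x \<cdot> x = 0"
proof -
  define S where "S = span {y, z}"
  have S: "x \<in> S \<longleftrightarrow> (\<exists>b c. x = b \<odot> y + c \<odot> z)" for x by (simp add: S_def in_span2)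
  have eS: "a = 0" if "a \<odot> e + v = 0" "v \<in> S" for a v
    using that indep3D[OF ind, of a] by (auto simp: S add.assoc)
  have prods: "y \<cdot> y \<in> S" "y \<cdot> z \<in> S" "z \<cdot> y \<in> S" "z \<cdot> z \<in> S" using closed by (simp_all add: S)
  have mulS: "u \<cdot> v \<in> S" if uv: "u \<in> S" "v \<in> S" for u v
  proof -
    obtain b c where u: "u = b \<odot> y + c \<odot> z" using uv S by blast
    obtain b' c' where v: "v = b' \<odot> y + c' \<odot> z" using uv S by blast
    show ?thesis using prods unfolding u v S_def
      by (simp add: mul_linear span_add span_scale)
  qed
  show thesis
  proof (cases "\<forall>x\<in>S. x \<cdot> x = 0")
    case True
    have yS: "y \<in> S" "z \<in> S" "y + z \<in> S" by (simp_all add: S_def span_base span_add)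
    then have sq: "y \<cdot> y = 0" "z \<cdot> z = 0" "(y + z) \<cdot> (y + z) = 0" using True by blast+
    have zy: "z \<cdot> y = - (y \<cdot> z)"
      using sq by (simp add: mul_linear eq_neg_iff_add_eq_0 add.commute)
    have "y \<cdot> z = 0"
    proof (rule ccontr)
      assume nz: "y \<cdot> z \<noteq> 0"
      obtain b c where bc: "y \<cdot> z = b \<odot> y + c \<odot> z" using closed by blast
      have "y \<cdot> (y \<cdot> z) = 0" "y \<cdot> z \<cdot> z = 0"
        using sq assoc[of y y z] assoc[of y z z] by simp_all
      then have "y \<cdot> (b \<odot> y + c \<odot> z) = 0" "(b \<odot> y + c \<odot> z) \<cdot> z = 0" by (simp_all add: bc)
      then have "c = 0" "b = 0" using nz sq by (simp_all add: mul_linear)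
      then show False using nz bc by simp
    qed
    then show thesis using zero sq zy by simp
  next
    case False
    then obtain x where x: "x \<in> S" "x \<cdot> x \<noteq> 0" by blast
    then obtain b c where bc: "x = b \<odot> y + c \<odot> z" using S by blast
    have x4: "x \<cdot> x \<cdot> x \<cdot> x = 0" using nil[OF bc] .
    have powS: "x \<cdot> x \<in> S" "x \<cdot> x \<cdot> x \<in> S" using x mulS by blast+
    have x3: "x \<cdot> x \<cdot> x = 0"
    proof (rule ccontr)
      assume nz: "x \<cdot> x \<cdot> x \<noteq> 0"
      \<comment> \<open>Adding \<open>e\<close> to the three powers turns the dimension count in the
        plane into one in the whole space; \<open>eS\<close> then removes the coefficient of
        \<open>e\<close>.\<close>
      obtain p q r s where rel: "p \<odot> e + q \<odot> x + r \<odot> (x \<cdot> x) + s \<odot> (x \<cdot> x \<cdot> x) = 0"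
        "p \<noteq> 0 \<or> q \<noteq> 0 \<or> r \<noteq> 0 \<or> s \<noteq> 0" by (rule dependent4)
      have "q \<odot> x + r \<odot> (x \<cdot> x) + s \<odot> (x \<cdot> x \<cdot> x) \<in> S"
        using x powS unfolding S_def by (intro span_add span_scale)
      then have [simp]: "p = 0" using eS[of p] rel(1) by (simp add: add.assoc)
      from rel(1) have rel': "q \<odot> x + r \<odot> (x \<cdot> x) + s \<odot> (x \<cdot> x \<cdot> x) = 0" by simp
      then have "x \<cdot> (x \<cdot> (q \<odot> x + r \<odot> (x \<cdot> x) + s \<odot> (x \<cdot> x \<cdot> x))) = 0" by simp
      then have [simp]: "q = 0" using nz x4 by (simp add: mul_linear word_simps)
      from rel' have "x \<cdot> (q \<odot> x + r \<odot> (x \<cdot> x) + s \<odot> (x \<cdot> x \<cdot> x)) = 0" by simp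
      then have "r = 0" using nz x4 by (simp add: mul_linear word_simps)
      then show False using rel nz by simp
    qed
    have "indep3 e x (x \<cdot> x)"
    proof (unfold indep3_def, intro allI impI)
      fix p q r assume rel: "p \<odot> e + q \<odot> x + r \<odot> (x \<cdot> x) = 0"
      have "q \<odot> x + r \<odot> (x \<cdot> x) \<in> S"
        using x powS unfolding S_def by (intro span_add span_scale)
      then have [simp]: "p = 0" using eS[of p] rel by (simp add: add.assoc)
      from rel have "x \<cdot> (q \<odot> x + r \<odot> (x \<cdot> x)) = 0" by simp
      then have "q = 0" using x(2) x3 by (simp add: mul_linear word_simps)
      then show "p = 0 \<and> q = 0 \<and> r = 0" using rel x(2) by simp
    qed
    then show thesis using cyclic bc x3 by blast
  qed
qed

end

section \<open>Algebras with an idempotent but no orthogonal pair of nonzero ones\<close>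

locale perm_algebra3_one_idempotent = perm_algebra3 +
  fixes e :: 'a
  assumes e: "e \<cdot> e = e" "e \<noteq> 0"
    and no_orthogonal: "\<And>f g. f \<cdot> f = f \<Longrightarrow> g \<cdot> g = g \<Longrightarrow> f \<cdot> g = 0 \<Longrightarrow> g \<cdot> f = 0 \<Longrightarrow> f = 0 \<or> g = 0"
begin

text \<open>Otherwise Fitting's lemma gives an idempotent built from powers of \<open>y\<close>,
  hence orthogonal to \<open>e\<close>.\<close>

lemma peirce00_nilpotent:
  assumes "peirce00 e y"
  shows "y \<cdot> y \<cdot> y \<cdot> y = 0"
proof (rule fitting[of y])
  fix u p q r
  assume u: "u = p \<odot> y + q \<odot> (y \<cdot> y) + r \<odot> (y \<cdot> y \<cdot> y)"
    and uuu: "u \<cdot> u \<cdot> u \<cdot> u = u \<cdot> u \<cdot> u" "u \<cdot> u \<cdot> u \<noteq> 0"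
  have y: "e \<cdot> y = 0" "y \<cdot> e = 0" using assms by (simp_all add: peirce00_def)
  have "e \<cdot> (y \<cdot> v) = 0" "y \<cdot> v \<cdot> e = 0" for v
    using y assoc right_comm by (metis mul_zero_left)+
  then have eu: "e \<cdot> u = 0" "u \<cdot> e = 0" by (simp_all add: u mul_linear assoc y)
  define g where "g = u \<cdot> u \<cdot> u"
  have "g \<cdot> g = g" using uuu(1) by (simp add: g_def assoc[symmetric])
  moreover have "e \<cdot> g = 0" "g \<cdot> e = 0"
    unfolding g_def using eu assoc right_comm by (metis mul_zero_left)+
  ultimately show ?thesis using no_orthogonal[OF e(1), of g] e uuu(2) by (simp add: g_def)
qed

text \<open>\<open>g\<close> and \<open>e - g\<close> are orthogonal idempotents.\<close>

lemma peirce11_idempotent: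
  assumes "g \<cdot> g = g" "g \<noteq> 0" "peirce11 e g"
  shows "g = e"
proof -
  have "e \<cdot> g = g" "g \<cdot> e = g" using assms by (simp_all add: peirce11_def)
  then show ?thesis using no_orthogonal[of g "e - g"] assms e by (simp add: mul_linear)
qed

text \<open>Otherwise the idempotent from Fitting's lemma lies in component \<open>11\<close>, so it
  is \<open>e\<close>; but it kills \<open>v\<close>, which \<open>e\<close> fixes.\<close>

lemma peirce11_nilpotent_if_kernel:
  assumes "peirce11 e x" "v \<noteq> 0" "e \<cdot> v = v" "x \<cdot> v = 0"
  shows "x \<cdot> x \<cdot> x \<cdot> x = 0"
proof (rule fitting[of x])
  fix u p q r
  assume u: "u = p \<odot> x + q \<odot> (x \<cdot> x) + r \<odot> (x \<cdot> x \<cdot> x)"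
    and uuu: "u \<cdot> u \<cdot> u \<cdot> u = u \<cdot> u \<cdot> u" "u \<cdot> u \<cdot> u \<noteq> 0"
  have x: "e \<cdot> x = x" "x \<cdot> e = x" using assms(1) by (simp_all add: peirce11_def)
  have ex: "e \<cdot> (x \<cdot> w) = x \<cdot> w" "x \<cdot> w \<cdot> e = x \<cdot> w" for w
    using x assoc right_comm by metis+
  have eu: "e \<cdot> u = u" "u \<cdot> e = u" using ex by (simp_all add: u mul_linear assoc x)
  have uv: "u \<cdot> v = 0" using assms(4) by (simp add: u mul_linear assoc)
  define g where "g = u \<cdot> u \<cdot> u"
  have "g \<cdot> g = g" using uuu(1) by (simp add: g_def assoc[symmetric])
  moreover have "peirce11 e g"
    unfolding g_def peirce11_def using eu assoc right_comm by metis
  ultimately have "g = e" using peirce11_idempotent uuu(2) by (simp add: g_def)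
  moreover have "g \<cdot> v = 0" by (simp add: g_def assoc uv)
  ultimately show ?thesis using assms(2,3) by simp
qed

text \<open>Nilpotency is demanded in the component \<open>11\<close> only, which contains \<open>e\<close>; in \<open>01\<close> and \<open>00\<close> it
  is automatic.\<close>

definition homogeneous :: "'a \<Rightarrow> bool" where
  "homogeneous y \<longleftrightarrow> peirce11 e y \<and> y \<cdot> y \<cdot> y \<cdot> y = 0 \<or> peirce01 e y \<or> peirce00 e y"

text \<open>In component \<open>11\<close>, subtracting an eigenvalue of \<open>y\<close> creates a
  kernel vector fixed by \<open>e\<close>, which forces nilpotency.\<close>

lemma homogeneous_shift:
  assumes "peirce11 e y \<or> peirce01 e y \<or> peirce00 e y"
  shows "\<exists>l. homogeneous (y - l \<odot> e)"
proof (cases "peirce11 e y")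
  case False
  then have "homogeneous (y - 0 \<odot> e)" using assms by (simp add: homogeneous_def)
  then show ?thesis by blast
next
  case True
  obtain l v where lv: "v \<noteq> 0" "e \<cdot> v = v" "y \<cdot> v = l \<odot> v"
    using eigenvector_exists[OF e True] by blast
  have 11: "peirce11 e (y - l \<odot> e)" using True e by (simp add: peirce11_def mul_linear)
  have "(y - l \<odot> e) \<cdot> v = 0" using lv by (simp add: mul_linear)
  then have "homogeneous (y - l \<odot> e)"
    using peirce11_nilpotent_if_kernel[OF 11 lv(1,2)] 11 by (simp add: homogeneous_def)
  then show ?thesis by blast
qed

lemma homogeneous_basis: obtains y z where "indep3 e y z" "homogeneous y" "homogeneous z"
proof -
  obtain y where y: "indep2 e y" "peirce11 e y \<or> peirce01 e y \<or> peirce00 e y"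
    using exists_indep2[OF peirce_span[OF e(1)] e(2)] by auto
  obtain z where z: "indep3 e y z" "peirce11 e z \<or> peirce01 e z \<or> peirce00 e z"
    using exists_indep3[OF peirce_span[OF e(1)] y(1)] by auto
  obtain l where l: "homogeneous (y - l \<odot> e)" using homogeneous_shift[OF y(2)] by blast
  obtain m where m: "homogeneous (z - m \<odot> e)" using homogeneous_shift[OF z(2)] by blast
  have "indep3 e (y - l \<odot> e) (z - m \<odot> e)"
  proof (unfold indep3_def, intro allI impI)
    fix p q r assume "p \<odot> e + q \<odot> (y - l \<odot> e) + r \<odot> (z - m \<odot> e) = 0"
    then have "(p - q * l - r * m) \<odot> e + q \<odot> y + r \<odot> z = 0" by (simp add: algebra_simps)
    then have "p - q * l - r * m = 0 \<and> q = 0 \<and> r = 0" by (rule indep3D[OF z(1)])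
    then show "p = 0 \<and> q = 0 \<and> r = 0" by auto
  qed
  then show thesis using that l m by blast
qed

text \<open>Right multiplication by the fourth power of \<open>y\<close> scales \<open>z\<close> by
  the fourth power of \<open>c\<close>.\<close>

lemma scalar_nilpotent:
  assumes "z \<cdot> y = c \<odot> z" "y \<cdot> y \<cdot> y \<cdot> y = 0" "z \<noteq> 0"
  shows "c = 0"
proof -
  have "z \<cdot> (y \<cdot> y \<cdot> y \<cdot> y) = (c * c * c * c) \<odot> z"
    by (simp add: assoc[symmetric] mul_linear assms(1) ac_simps)
  then show ?thesis using assms(2,3) by simp
qed

text \<open>Applying the relation to a vector killed by \<open>y\<close> and fixed by
  \<open>e\<close> gives \<open>a = 0\<close>; then \<open>scalar_nilpotent\<close> removes
  \<open>b\<close>.\<close>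

lemma peirce11_plane_square_zero:
  assumes y: "peirce11 e y" "y \<cdot> y \<cdot> y \<cdot> y = 0" and rel: "y \<cdot> y = a \<odot> e + b \<odot> y"
  shows "y \<cdot> y = 0"
proof -
  have ye: "e \<cdot> y = y" "y \<cdot> e = y" using y by (simp_all add: peirce11_def)
  obtain w where w: "w \<noteq> 0" "y \<cdot> w = 0"
    "w = e \<or> w = y \<cdot> e \<or> w = y \<cdot> (y \<cdot> e) \<or> w = y \<cdot> (y \<cdot> (y \<cdot> e))"
    by (rule nilpotent_kernel[OF y(2) e(2)])
  have "e \<cdot> (y \<cdot> v) = y \<cdot> v" for v using ye assoc by metis
  then have "e \<cdot> w = w" using w(3) e(1) by auto
  have "(a \<odot> e + b \<odot> y) \<cdot> w = 0" using rel w(2) by (metis assoc mul_zero_right)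
  then have "a = 0" using \<open>e \<cdot> w = w\<close> w by (simp add: mul_linear)
  then have "y \<cdot> y = b \<odot> y" using rel by simp
  moreover from this have "b = 0 \<or> y = 0" using scalar_nilpotent[OF _ y(2)] by blast
  ultimately show ?thesis by auto
qed

text \<open>\<open>e\<close> is a unit, and \<open>y\<close>, \<open>z\<close> span a nil plane:
  zero multiplication gives \<open>A09\<close>, the cyclic case \<open>A10\<close>.\<close>

lemma classification_11_11:
  assumes ind: "indep3 e y z"
    and y: "peirce11 e y" "y \<cdot> y \<cdot> y \<cdot> y = 0" and z: "peirce11 e z" "z \<cdot> z \<cdot> z \<cdot> z = 0"
  shows "\<exists>B \<in> {A09, A10}. algebra_isomorphic smul mul (*s) B"
proof -
  have ye: "e \<cdot> y = y" "y \<cdot> e = y" "e \<cdot> z = z" "z \<cdot> e = z"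
    using y z by (simp_all add: peirce11_def)
  have ey: "e \<cdot> (y \<cdot> v) = y \<cdot> v" "e \<cdot> (z \<cdot> v) = z \<cdot> v" for v using ye assoc by metis+
  text \<open>A common null vector \<open>w\<close> of \<open>y\<close> and \<open>z\<close> shows that products of \<open>y\<close> and \<open>z\<close> have no
    \<open>e\<close>-coefficient.\<close>
  obtain v where v: "v \<noteq> 0" "y \<cdot> v = 0"
    "v = e \<or> v = y \<cdot> e \<or> v = y \<cdot> (y \<cdot> e) \<or> v = y \<cdot> (y \<cdot> (y \<cdot> e))"
    by (rule nilpotent_kernel[OF y(2) e(2)])
  have ev: "e \<cdot> v = v" using v(3) e(1) ey by auto
  obtain w where w: "w \<noteq> 0" "z \<cdot> w = 0"
    "w = v \<or> w = z \<cdot> v \<or> w = z \<cdot> (z \<cdot> v) \<or> w = z \<cdot> (z \<cdot> (z \<cdot> v))"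
    by (rule nilpotent_kernel[OF z(2) v(1)])
  have ew: "e \<cdot> w = w" using w(3) ev ey by auto
  \<comment> \<open>The kernel of left multiplication by \<open>y\<close> is stable under left
    multiplication by \<open>z\<close>, by the perm identity.\<close>
  have "y \<cdot> (z \<cdot> u) = 0" if "y \<cdot> u = 0" for u
    using that assoc right_comm by (metis mul_zero_left)
  then have yw: "y \<cdot> w = 0" using w(3) v(2) by auto
  have no_e: "\<exists>b c. t = b \<odot> y + c \<odot> z" if t: "t \<cdot> w = 0" for t
  proof -
    obtain a b c where abc: "t = a \<odot> e + b \<odot> y + c \<odot> z" by (rule indep3_spans[OF ind])
    have "(a \<odot> e + b \<odot> y + c \<odot> z) \<cdot> w = 0" using t abc by simp
    then have "a = 0" using w(1,2) yw ew by (simp add: mul_linear)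
    then show ?thesis using abc by auto
  qed
  have nil: "x \<cdot> x \<cdot> x \<cdot> x = 0" if x: "x = b \<odot> y + c \<odot> z" for b c x
  proof (rule peirce11_nilpotent_if_kernel[OF _ w(1) ew])
    show "peirce11 e x" "x \<cdot> w = 0" by (simp_all add: x peirce11_def mul_linear ye yw w(2))
  qed
  show ?thesis
  proof (rule nil_plane[OF ind _ _ _ _ nil])
    assume "y \<cdot> y = 0" "y \<cdot> z = 0" "z \<cdot> y = 0" "z \<cdot> z = 0"
    then have "algebra_isomorphic smul mul (*s) A09" unfolding A09_def
      by (intro iso_table[OF ind]) (simp_all add: axis_def e ye)
    then show ?thesis by blast
  next
    fix x b c assume x: "x = b \<odot> y + c \<odot> z" and ind': "indep3 e x (x \<cdot> x)" and "x \<cdot> x \<cdot> x = 0"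
    have ex: "e \<cdot> x = x" "x \<cdot> e = x" by (simp_all add: x mul_linear ye)
    then have "e \<cdot> (x \<cdot> x) = x \<cdot> x" "x \<cdot> x \<cdot> e = x \<cdot> x" "x \<cdot> (x \<cdot> x) = 0" "x \<cdot> x \<cdot> (x \<cdot> x) = 0"
      using \<open>x \<cdot> x \<cdot> x = 0\<close> assoc right_comm by (metis mul_zero_left)+
    then have "algebra_isomorphic smul mul (*s) A10" unfolding A10_def
      by (intro iso_table[OF ind']) (simp_all add: axis_def e ex \<open>x \<cdot> x \<cdot> x = 0\<close>)
    then show ?thesis by blast
  qed (use no_e assoc yw w(2) in \<open>simp_all add: assoc\<close>)
qed

text \<open>\<open>e\<close> fixes \<open>y \<cdot> y\<close> and kills \<open>z \<cdot> y\<close>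
  from the left, which confines them to the plane of \<open>e\<close>, \<open>y\<close> and the line
  of \<open>z\<close>. Nilpotency of \<open>y\<close> makes both zero.\<close>

lemma classification_11_01:
  assumes ind: "indep3 e y z"
    and y: "peirce11 e y" "y \<cdot> y \<cdot> y \<cdot> y = 0" and z: "peirce01 e z"
  shows "algebra_isomorphic smul mul (*s) A16"
proof -
  have ye: "e \<cdot> y = y" "y \<cdot> e = y" and ze: "z \<cdot> e = z" "\<And>v. v \<cdot> z = 0"
    using y z peirce01_left_zero[OF z] by (simp_all add: peirce11_def peirce01_def)
  have z0: "z \<noteq> 0" using ind indep2_imp_nonzero indep3_imp_indep2 indep3_swap12 indep3_swap23 by blast
  have "y \<cdot> y = 0"
  proof -
    obtain a b c where abc: "y \<cdot> y = a \<odot> e + b \<odot> y + c \<odot> z" by (rule indep3_spans[OF ind])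
    have "e \<cdot> (y \<cdot> y) = y \<cdot> y" using ye assoc by metis
    then have "e \<cdot> (a \<odot> e + b \<odot> y + c \<odot> z) = a \<odot> e + b \<odot> y + c \<odot> z" by (simp only: abc)
    then have "c \<odot> z = 0" by (simp add: mul_linear e ye ze)
    then show ?thesis using peirce11_plane_square_zero[OF y, of a b] abc by simp
  qed
  moreover have "z \<cdot> y = 0"
  proof -
    obtain a b c where abc: "z \<cdot> y = a \<odot> e + b \<odot> y + c \<odot> z" by (rule indep3_spans[OF ind])
    have "e \<cdot> (z \<cdot> y) = 0" using ze(2)[of e] by (simp add: assoc[symmetric])
    then have "e \<cdot> (a \<odot> e + b \<odot> y + c \<odot> z) = 0" by (simp only: abc)
    then have "a \<odot> e + b \<odot> y + 0 \<odot> z = 0" by (simp add: mul_linear e ye ze)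
    then have "a = 0 \<and> b = 0" using indep3D[OF ind] by blast
    then have "z \<cdot> y = c \<odot> z" using abc by simp
    moreover from this have "c = 0" using scalar_nilpotent[OF _ y(2) z0] by blast
    ultimately show ?thesis by simp
  qed
  \<comment> \<open>The table has the \<open>01\<close> vector second and the \<open>11\<close>
    vector third.\<close>
  ultimately show ?thesis unfolding A16_def
    by (intro iso_table[OF indep3_swap23[OF ind]]) (simp_all add: axis_def e ye ze)
qed

lemma classification_11_00:
  assumes ind: "indep3 e y z"
    and y: "peirce11 e y" "y \<cdot> y \<cdot> y \<cdot> y = 0" and z: "peirce00 e z"
  shows "algebra_isomorphic smul mul (*s) A02"
proof -
  have ye: "e \<cdot> y = y" "y \<cdot> e = y" and ze: "e \<cdot> z = 0" "z \<cdot> e = 0"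
    using y z by (simp_all add: peirce11_def peirce00_def)
  have yz: "y \<cdot> z = 0" "z \<cdot> y = 0" using peirce_mult_zero y z by blast+
  have z0: "z \<noteq> 0" using ind indep2_imp_nonzero indep3_imp_indep2 indep3_swap12 indep3_swap23 by blast
  have "y \<cdot> y = 0"
  proof -
    obtain a b c where abc: "y \<cdot> y = a \<odot> e + b \<odot> y + c \<odot> z" by (rule indep3_spans[OF ind])
    have "e \<cdot> (y \<cdot> y) = y \<cdot> y" using ye assoc by metis
    then have "e \<cdot> (a \<odot> e + b \<odot> y + c \<odot> z) = a \<odot> e + b \<odot> y + c \<odot> z" by (simp only: abc)
    then have "c \<odot> z = 0" by (simp add: mul_linear e ye ze)
    then show ?thesis using peirce11_plane_square_zero[OF y, of a b] abc by simp
  qed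
  moreover have "z \<cdot> z = 0"
  proof -
    obtain a b c where abc: "z \<cdot> z = a \<odot> e + b \<odot> y + c \<odot> z" by (rule indep3_spans[OF ind])
    have "e \<cdot> (z \<cdot> z) = 0" using ze by (simp add: assoc[symmetric])
    then have "e \<cdot> (a \<odot> e + b \<odot> y + c \<odot> z) = 0" by (simp only: abc)
    then have "a \<odot> e + b \<odot> y + 0 \<odot> z = 0" by (simp add: mul_linear e ye ze)
    then have "a = 0 \<and> b = 0" using indep3D[OF ind] by blast
    then have "z \<cdot> z = c \<odot> z" using abc by simp
    moreover from this have "c = 0" using scalar_nilpotent[OF _ peirce00_nilpotent[OF z] z0] by blast
    ultimately show ?thesis by simp
  qed
  ultimately show ?thesis unfolding A02_def
    by (intro iso_table[OF ind]) (simp_all add: axis_def e ye ze yz)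
qed

lemma classification_01_01:
  assumes ind: "indep3 e y z" and y: "peirce01 e y" and z: "peirce01 e z"
  shows "algebra_isomorphic smul mul (*s) A18"
proof -
  have "y \<cdot> e = y" "z \<cdot> e = z" using y z by (simp_all add: peirce01_def)
  then show ?thesis unfolding A18_def
    by (intro iso_table[OF ind])
      (simp_all add: axis_def e peirce01_left_zero[OF y] peirce01_left_zero[OF z])
qed

lemma classification_01_00:
  assumes ind: "indep3 e y z" and y: "peirce01 e y" and z: "peirce00 e z"
  shows "algebra_isomorphic smul mul (*s) A21"
proof -
  have ye: "y \<cdot> e = y" "\<And>v. v \<cdot> y = 0" and ze: "e \<cdot> z = 0" "z \<cdot> e = 0"
    using y z peirce01_left_zero[OF y] by (simp_all add: peirce01_def peirce00_def)
  have yz: "y \<cdot> z = 0" using peirce_mult_zero(1) y z by blast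
  have z0: "z \<noteq> 0" using ind indep2_imp_nonzero indep3_imp_indep2 indep3_swap12 indep3_swap23 by blast
  have "z \<cdot> z = 0"
  proof -
    obtain a b c where abc: "z \<cdot> z = a \<odot> e + b \<odot> y + c \<odot> z" by (rule indep3_spans[OF ind])
    \<comment> \<open>Right multiplication by \<open>e\<close> detects the coefficients of both
      \<open>e\<close> and \<open>y\<close>; left multiplication would lose that of
      \<open>y\<close>.\<close>
    have "z \<cdot> z \<cdot> e = 0" using ze by (simp add: assoc)
    then have "(a \<odot> e + b \<odot> y + c \<odot> z) \<cdot> e = 0" by (simp only: abc)
    then have "a \<odot> e + b \<odot> y + 0 \<odot> z = 0" by (simp add: mul_linear e ye ze)
    then have "a = 0 \<and> b = 0" using indep3D[OF ind] by blast
    then have "z \<cdot> z = c \<odot> z" using abc by simp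
    moreover from this have "c = 0" using scalar_nilpotent[OF _ peirce00_nilpotent[OF z] z0] by blast
    ultimately show ?thesis by simp
  qed
  then show ?thesis unfolding A21_def
    by (intro iso_table[OF ind]) (simp_all add: axis_def e ye ze yz)
qed

lemma classification_00_00:
  assumes ind: "indep3 e y z" and y: "peirce00 e y" and z: "peirce00 e z"
  shows "\<exists>B \<in> {A03, A11}. algebra_isomorphic smul mul (*s) B"
proof -
  have ye: "e \<cdot> y = 0" "y \<cdot> e = 0" "e \<cdot> z = 0" "z \<cdot> e = 0"
    using y z by (simp_all add: peirce00_def)
  have no_e: "\<exists>b c. t = b \<odot> y + c \<odot> z" if t: "e \<cdot> t = 0" for t
  proof -
    obtain a b c where abc: "t = a \<odot> e + b \<odot> y + c \<odot> z" by (rule indep3_spans[OF ind])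
    have "e \<cdot> (a \<odot> e + b \<odot> y + c \<odot> z) = 0" using t abc by simp
    then have "a = 0" using e ye by (simp add: mul_linear)
    then show ?thesis using abc by auto
  qed
  have nil: "x \<cdot> x \<cdot> x \<cdot> x = 0" if x: "x = b \<odot> y + c \<odot> z" for b c x
    by (rule peirce00_nilpotent) (simp add: x peirce00_def mul_linear ye)
  show ?thesis
  proof (rule nil_plane[OF ind _ _ _ _ nil])
    assume "y \<cdot> y = 0" "y \<cdot> z = 0" "z \<cdot> y = 0" "z \<cdot> z = 0"
    then have "algebra_isomorphic smul mul (*s) A03" unfolding A03_def
      by (intro iso_table[OF ind]) (simp_all add: axis_def e ye)
    then show ?thesis by blast
  next
    fix x b c assume x: "x = b \<odot> y + c \<odot> z" and ind': "indep3 e x (x \<cdot> x)" and "x \<cdot> x \<cdot> x = 0"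
    have ex: "e \<cdot> x = 0" "x \<cdot> e = 0" by (simp_all add: x mul_linear ye)
    then have "e \<cdot> (x \<cdot> x) = 0" "x \<cdot> x \<cdot> e = 0" "x \<cdot> (x \<cdot> x) = 0" "x \<cdot> x \<cdot> (x \<cdot> x) = 0"
      using \<open>x \<cdot> x \<cdot> x = 0\<close> assoc right_comm by (metis mul_zero_left)+
    then have "algebra_isomorphic smul mul (*s) A11" unfolding A11_def
      by (intro iso_table[OF ind']) (simp_all add: axis_def e ex \<open>x \<cdot> x \<cdot> x = 0\<close>)
    then show ?thesis by blast
  qed (use no_e ye in \<open>simp_all add: assoc[symmetric]\<close>)
qed

lemma one_idempotent_classification:
  "\<exists>B \<in> {A02, A03, A09, A10, A11, A16, A18, A21}. algebra_isomorphic smul mul (*s) B"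
proof -
  obtain y z where ind: "indep3 e y z" and yz: "homogeneous y" "homogeneous z"
    by (rule homogeneous_basis)
  \<comment> \<open>Exchanging \<open>y\<close> and \<open>z\<close> reduces the nine pairs of types
    to six.\<close>
  note ind' = indep3_swap23[OF ind]
  consider "peirce11 e y" "y \<cdot> y \<cdot> y \<cdot> y = 0" | "peirce01 e y" | "peirce00 e y"
    using yz(1) unfolding homogeneous_def by blast
  then show ?thesis
  proof cases
    case 1
    then show ?thesis
      using classification_11_11[OF ind 1] classification_11_01[OF ind 1]
        classification_11_00[OF ind 1] yz(2)
      unfolding homogeneous_def by blast
  next
    case 2
    then show ?thesis
      using classification_11_01[OF ind' _ _ 2] classification_01_01[OF ind 2]
        classification_01_00[OF ind 2] yz(2)
      unfolding homogeneous_def by blast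
  next
    case 3
    then show ?thesis
      using classification_11_00[OF ind' _ _ 3] classification_01_00[OF ind' _ 3]
        classification_00_00[OF ind 3] yz(2)
      unfolding homogeneous_def by blast
  qed
qed

end

section \<open>Assembly of the classification\<close>

context perm_algebra3
begin

lemma classification:
  assumes "x \<cdot> y \<noteq> 0"
  shows "\<exists>B \<in> {A01, A02, A03, A04, A05, A06, A07, A08, A09, A10, A11, A12, A13}
              \<union> {A14 \<alpha> | \<alpha>. \<alpha> \<noteq> 0} \<union> {A16, A18, A21, A24}.
            algebra_isomorphic smul mul (*s) B"
proof (cases "\<forall>x. x \<cdot> x \<cdot> x \<cdot> x = 0")
  case True
  then show ?thesis using nilpotent_classification[OF _ assms] by blast
next
  case False
  then obtain x where "x \<cdot> x \<cdot> x \<cdot> x \<noteq> 0" by blast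
  then obtain u where u: "u \<cdot> u \<cdot> u \<cdot> u = u \<cdot> u \<cdot> u" "u \<cdot> u \<cdot> u \<noteq> 0"
    using fitting[of x] by metis
  define e where "e = u \<cdot> u \<cdot> u"
  have e: "e \<cdot> e = e" "e \<noteq> 0" using u by (simp_all add: e_def assoc[symmetric])
  show ?thesis
  proof (cases "\<exists>f g. f \<cdot> f = f \<and> g \<cdot> g = g \<and> f \<cdot> g = 0 \<and> g \<cdot> f = 0 \<and> f \<noteq> 0 \<and> g \<noteq> 0")
    case True
    then show ?thesis using two_idempotents_classification by blast
  next
    case False
    interpret perm_algebra3_one_idempotent smul mul e
    proof unfold_locales
      show "e \<cdot> e = e" "e \<noteq> 0" by (fact e)+
      show "f = 0 \<or> g = 0" if "f \<cdot> f = f" "g \<cdot> g = g" "f \<cdot> g = 0" "g \<cdot> f = 0" for f g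
        using that False by blast
    qed
    show ?thesis using one_idempotent_classification by blast
  qed
qed

end

theorem corollary14:
  fixes smul :: "complex \<Rightarrow> 'a::ab_group_add \<Rightarrow> 'a"
    and mul :: "'a \<Rightarrow> 'a \<Rightarrow> 'a"
  assumes "binary_perm_algebra smul mul"
    and "vector_space.dim smul (UNIV :: 'a set) = 3"
    and "\<exists>x y. mul x y \<noteq> 0"
  shows "(\<exists>B \<in> {A01, A02, A03, A04, A05, A06, A07, A08, A09, A10, A11, A12, A13}
              \<union> {A14 \<alpha> | \<alpha>. \<alpha> \<noteq> 0} \<union> {A16, A18, A21, A24}.
            algebra_isomorphic smul mul (*s) B)
         \<and> perm_algebra smul mul"
proof -
  have binary: "perm_on mul (generated_subalgebra smul mul {x, y})" for x y
    using assms(1) by (simp add: binary_perm_algebra_def)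
  interpret nonassoc_algebra smul mul using assms(1) by (simp add: binary_perm_algebra_def)
  interpret algebra3 smul mul by unfold_locales (fact assms(2))
  have perm: "perm_on mul UNIV" by (rule perm_on_if_binary_perm[OF binary])
  interpret perm_algebra3 smul mul using perm by unfold_locales (auto simp: perm_on_def)
  have "perm_algebra smul mul"
    using perm nonassoc_algebra_axioms by (simp add: perm_algebra_def)
  then show ?thesis using assms(3) classification by blast
qed

end
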